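(* Let $r\ge 1$, let $A=\{a(1),\dots,a(r)\}$ be a set of $r$ distinct integers such that $\sum_{i=1}^{k-1}a(i)<a(k)$ for all $1\le k\le r$ and such that the $2^r-1$ sums of nonempty collections of distinct elements of $A$ are all distinct, and let $N$ be a positive integer with $N\ge a(1)+\cdots+a(r)$. For integers $n\ge 1$ and $k\ge 0$: - let $F(-A_N;k,n)$ denote the number of overpartitions of $n$ into parts taken from $-A_N$, having exactly $k$ non-overlined parts; - let $G(-A'_N;k,n)$ denote the number of overpartitions of $n$ into parts taken from $-A'_N$, of the form $n=\lambda_1+\cdots+\lambda_s$ (with $\lambda_1\ge\cdots\ge\lambda_s$), having exactly $k$ non-overlined parts, such that for all $1\le i\le s-1$ $$\lambda_i-\lambda_{i+1}\ \ge\ N\bigl(w(\beta_N(-\lambda_i))-1+\chi(\overline{\lambda_{i+1}})\bigr)+v(\beta_N(-\lambda_i))-\beta_N(-\lambda_i),$$ and $$\lambda_s\ \ge\ N\bigl(w(\beta_N(-\lambda_s))-1\bigr),$$ where $\chi(\overline{\lambda_{i+1}})=1$ if $\lambda_{i+1}$ is overlined and $0$ otherwise. Then $F(-A_N;k,n)=G(-A'_N;k,n)$ for all $n\ge1$ and $k\ge 0$.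
   Context: A partition of $n$ is a non-increasing sequence of positive integers whose sum is $n$. An overpartition of $n$ is a partition of $n$ in which the first occurrence of each number may be overlined (so among equal parts only the first listed one can be overlined). For example, $\overline{2}+2$ is an overpartition of $4$, with one non-overlined part. The numerical value of an overlined part is that of the underlying integer. Let $A'$ be the set of the $2^r-1$ sums of nonempty collections of distinct elements of $A$. Each $\alpha\in A'$ has a unique such defining sum; $w(\alpha)$ is the number of terms in the defining sum of $\alpha$, and $v(\alpha)$ is the smallest $a(i)$ appearing in it. Note that the condition for $k=1$ says $a(1)>0$. $-A_N$ is the set of positive integers congruent to $-a(i)$ modulo $N$ for some $i$, and $-A'_N$ is the set of positive integers congruent to $-\alpha$ modulo $N$ for some $\alpha\in A'$. $\beta_N(m)$ denotes the least positive residue of $m$ modulo $N$, i.e. the element of $\{1,\dots,N\}$ congruent to $m$ modulo $N$. Thus $\beta_N(-\lambda)\in A'$ for every $\lambda\in -A'_N$. *)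

theory Defs
  imports Main "HOL-Number_Theory.Cong"
begin

text \<open>
  A part of an overpartition is a pair \<open>(m, b)\<close>: the value \<open>m\<close> and whether it is overlined.
  Only the first listed part of a given value may be overlined.
\<close>

definition is_overpartition :: "(nat \<times> bool) list \<Rightarrow> nat \<Rightarrow> bool" where
  "is_overpartition xs n \<longleftrightarrow>
     sorted_wrt (\<ge>) (map fst xs) \<and>
     (\<forall>p\<in>set xs. fst p > 0) \<and>
     sum_list (map fst xs) = n \<and>
     (\<forall>i<length xs. snd (xs ! i) \<longrightarrow> (\<forall>j<i. fst (xs ! j) \<noteq> fst (xs ! i)))"

definition num_non_overlined :: "(nat \<times> bool) list \<Rightarrow> nat" where
  "num_non_overlined xs = length (filter (\<lambda>p. \<not> snd p) xs)"

text \<open>The set \<open>A'\<close>.\<close>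

definition subset_sums :: "int set \<Rightarrow> int set" where
  "subset_sums A = {\<Sum>S |S. S \<subseteq> A \<and> S \<noteq> {}}"

text \<open>
  The terms of the defining sum of \<open>\<alpha> \<in> A'\<close>; meaningful when the nonempty subset sums of \<open>A\<close>
  are distinct.
\<close>

definition defining_subset :: "int set \<Rightarrow> int \<Rightarrow> int set" where
  "defining_subset A \<alpha> = (THE S. S \<subseteq> A \<and> S \<noteq> {} \<and> \<Sum>S = \<alpha>)"

definition w :: "int set \<Rightarrow> int \<Rightarrow> nat" where
  "w A \<alpha> = card (defining_subset A \<alpha>)"

definition v :: "int set \<Rightarrow> int \<Rightarrow> int" where
  "v A \<alpha> = Min (defining_subset A \<alpha>)"

text \<open>The sets \<open>-A\<^sub>N\<close> and \<open>-A'\<^sub>N\<close> (for \<open>B = A\<close> and \<open>B = A'\<close>).\<close>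

definition neg_residues :: "nat \<Rightarrow> int set \<Rightarrow> nat set" where
  "neg_residues N B = {m. m > 0 \<and> (\<exists>b\<in>B. [int m = - b] (mod int N))}"

definition \<beta> :: "nat \<Rightarrow> int \<Rightarrow> int" where
  "\<beta> N m = (THE b. b \<in> {1..int N} \<and> [b = m] (mod int N))"

definition \<chi> :: "nat \<times> bool \<Rightarrow> int" where
  "\<chi> p = (if snd p then 1 else 0)"

text \<open>
  List positions start at 0, so \<open>xs ! i\<close> is the part with index \<open>i + 1\<close>.  The right-hand side
  of the difference condition may be negative, hence the inequalities are between integers.
\<close>

definition difference_condition :: "int set \<Rightarrow> nat \<Rightarrow> (nat \<times> bool) list \<Rightarrow> bool" where
  "difference_condition A N xs \<longleftrightarrow>
     (\<forall>i. i + 1 < length xs \<longrightarrow>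
        (let b = \<beta> N (- int (fst (xs ! i))) in
         int (fst (xs ! i)) - int (fst (xs ! (i + 1)))
           \<ge> int N * (int (w A b) - 1 + \<chi> (xs ! (i + 1))) + v A b - b))"

definition last_part_condition :: "int set \<Rightarrow> nat \<Rightarrow> (nat \<times> bool) list \<Rightarrow> bool" where
  "last_part_condition A N xs \<longleftrightarrow>
     (xs \<noteq> [] \<longrightarrow>
        int (fst (last xs)) \<ge> int N * (int (w A (\<beta> N (- int (fst (last xs))))) - 1))"

definition F :: "int set \<Rightarrow> nat \<Rightarrow> nat \<Rightarrow> nat \<Rightarrow> nat" where
  "F A N k n = card {xs. is_overpartition xs n \<and> fst ` set xs \<subseteq> neg_residues N A \<and>
                         num_non_overlined xs = k}"

definition G :: "int set \<Rightarrow> nat \<Rightarrow> nat \<Rightarrow> nat \<Rightarrow> nat" where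
  "G A N k n = card {xs. is_overpartition xs n \<and> fst ` set xs \<subseteq> neg_residues N (subset_sums A) \<and>
                         num_non_overlined xs = k \<and>
                         difference_condition A N xs \<and> last_part_condition A N xs}"

end

(*
  Write a part congruent to minus the sum of a(i), i in S, as N j - sum_S.  The difference
  condition between neighbours (j, S) and (j', T) then reads
    j - j' >= |S| - 1 + [next part overlined] + [max T < min S],
  so a sequence counted by G is a word of nonempty index sets together with an overpartition into
  parts >= 0 of the same length, the excess of the j's over their minimal values.  The size and
  the number of non-overlined parts are read off such a pair.

  Let f_m(k,n) count the objects whose smallest part is not both minimal non-overlined and of
  colour set with minimum > m.  Removing the smallest part gives
    f_m(k,n) = f_(m-1)(k,n) + f_m(k-1, n - (N - a(m))),
  and f_0(k,n) = f_r(k, n - N k), by adding 1 to all non-overlined parts of the excess.  With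
  colours treated independently, the objects counted by F satisfy the same relations.  On both
  sides toggling the overline of the first part shows that the sum of (-1)^k f_r(k,n) vanishes for
  n > 0, which supplies the missing value at k = 0, so these relations determine f.
*)

theory Submission
  imports Defs "HOL-Library.Multiset"
begin

subsection \<open>The recurrence\<close>

text \<open>Integer values allow the alternating sum. Its upper limit \<open>n\<close> misses no
  objects, since those of size \<open>n\<close> have at most \<open>n\<close> non-overlined
  parts.\<close>

definition andrews_recurrence ::
    "nat \<Rightarrow> nat \<Rightarrow> (nat \<Rightarrow> nat) \<Rightarrow> (nat \<Rightarrow> nat \<Rightarrow> nat \<Rightarrow> int) \<Rightarrow> bool" where
  "andrews_recurrence r N c f \<longleftrightarrow>
     (\<forall>k n. f 0 k n = (if N * k \<le> n then f r k (n - N * k) else 0)) \<and>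
     (\<forall>m k n. m < r \<longrightarrow> f (Suc m) k n =
        f m k n + (if 0 < k \<and> c (Suc m) \<le> n then f (Suc m) (k - 1) (n - c (Suc m)) else 0)) \<and>
     (\<forall>n. (\<Sum>k\<le>n. (-1) ^ k * f r k n) = (if n = 0 then 1 else 0))"

text \<open>Strong induction on \<open>n\<close>. For \<open>k > 0\<close> the recursive terms have
  strictly smaller size, because \<open>N\<close> and the \<open>c i\<close> are positive, except
  for the term \<open>f m k n\<close> supplied by the inner induction on \<open>m\<close>. For
  \<open>k = 0\<close> the first two clauses are circular, and the alternating sum yields
  \<open>f r 0 n\<close> from the values at \<open>k > 0\<close>.\<close>

lemma andrews_recurrence_unique:
  assumes f: "andrews_recurrence r N c f" and g: "andrews_recurrence r N c g"
    and N: "N > 0" and c: "\<And>i. i \<in> {1..r} \<Longrightarrow> c i > 0"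
    and "m \<le> r"
  shows "f m k n = g m k n"
  using \<open>m \<le> r\<close>
proof (induction n arbitrary: m k rule: less_induct)
  case (less n)
  have zero: "h 0 k n = (if N * k \<le> n then h r k (n - N * k) else 0)"
    and step: "m < r \<Longrightarrow> h (Suc m) k n =
        h m k n + (if 0 < k \<and> c (Suc m) \<le> n then h (Suc m) (k - 1) (n - c (Suc m)) else 0)"
    and alt: "(\<Sum>k\<le>n. (-1) ^ k * h r k n) = (if n = 0 then 1 else 0)"
    if "h \<in> {f, g}" for h m k n
    using f g that unfolding andrews_recurrence_def by blast+
  have pos: "f m k n = g m k n" if "k > 0" "m \<le> r" for m k
    using \<open>m \<le> r\<close>
  proof (induction m)
    case 0
    have "n - N * k < n" if "N * k \<le> n"
      using that N \<open>k > 0\<close> by (metis diff_less le_zero_eq nat_0_less_mult_iff neq0_conv)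
    then show ?case using less.IH[of "n - N * k" r k] by (simp add: zero)
  next
    case (Suc m)
    have "n - c (Suc m) < n" if "c (Suc m) \<le> n"
      using that c[of "Suc m"] Suc.prems by auto
    then show ?case
      using less.IH[of "n - c (Suc m)" "Suc m" "k - 1"] Suc by (simp add: step)
  qed
  have bot: "h r 0 n = (if n = 0 then 1 else 0) - (\<Sum>k\<in>{1..n}. (-1) ^ k * h r k n)"
    if "h \<in> {f, g}" for h
  proof -
    have "(\<Sum>k\<le>n. (-1) ^ k * h r k n) = h r 0 n + (\<Sum>k\<in>{1..n}. (-1) ^ k * h r k n)"
      by (subst sum.atMost_shift)
        (simp add: sum.atLeast_Suc_atMost_Suc_shift sum.atLeast1_atMost_eq)
    then show ?thesis using alt[OF that, of n] by linarith
  qed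
  have "(\<Sum>k\<in>{1..n}. (-1) ^ k * f r k n) = (\<Sum>k\<in>{1..n}. (-1) ^ k * g r k n)"
    by (intro sum.cong) (simp_all add: pos)
  then have top: "f r 0 n = g r 0 n" using bot[of f] bot[of g] by simp
  \<comment> \<open>At \<open>k = 0\<close> the first two clauses only say that the value does not
    depend on \<open>m\<close>, so agreement at \<open>m = r\<close> carries over to every
    \<open>m\<close>.\<close>
  have "f m 0 n = g m 0 n" if "m \<le> r" for m
    using that by (induction m) (simp_all add: zero step top)
  then show ?case using pos less.prems by (cases "k = 0") auto
qed

text \<open>A sign-reversing involution: flipping the overline of the first part changes the number
  of non-overlined parts by exactly one.\<close>

lemma alternating_sum_toggle_head:
  assumes "finite X" and "[] \<notin> X"
    and toggle: "\<And>p b xs. (p, b) # xs \<in> X \<Longrightarrow> (p, \<not> b) # xs \<in> X"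
    and bound: "\<And>xs. xs \<in> X \<Longrightarrow> num_non_overlined xs \<le> n"
  shows "(\<Sum>k\<le>n. (-1) ^ k * int (card {xs \<in> X. num_non_overlined xs = k})) = 0"
proof -
  define t where "t xs = (case xs of [] \<Rightarrow> [] | (p, b) # ys \<Rightarrow> (p, \<not> b) # ys)"
    for xs :: "(nat \<times> bool) list"
  let ?s = "\<lambda>xs. (-1::int) ^ num_non_overlined xs"
  have "(\<Sum>k\<le>n. (-1) ^ k * int (card {xs \<in> X. num_non_overlined xs = k}))
      = (\<Sum>k\<le>n. \<Sum>xs\<in>{xs \<in> X. num_non_overlined xs = k}. ?s xs)"
    by (intro sum.cong) auto
  also have "\<dots> = (\<Sum>xs\<in>X. ?s xs)"
    by (rule sum.group) (use assms in auto)
  finally have eq: "(\<Sum>k\<le>n. (-1) ^ k * int (card {xs \<in> X. num_non_overlined xs = k}))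
      = (\<Sum>xs\<in>X. ?s xs)" .
  have "(\<Sum>xs\<in>X. ?s xs) = (\<Sum>xs\<in>X. - ?s xs)"
  proof (rule sum.reindex_bij_witness[of _ t t])
    fix xs assume "xs \<in> X"
    then obtain p b ys where xs: "xs = (p, b) # ys"
      using \<open>[] \<notin> X\<close> by (metis list.exhaust surj_pair)
    show "t (t xs) = xs" "t (t xs) = xs" "t xs \<in> X" "t xs \<in> X"
      using toggle \<open>xs \<in> X\<close> by (auto simp: xs t_def)
    show "- ?s (t xs) = ?s xs" by (simp add: xs t_def num_non_overlined_def)
  qed
  then show ?thesis using eq by (simp add: sum_negf)
qed

subsection \<open>Overpartitions as a set and a multiset\<close>

definition dominates :: "nat \<times> bool \<Rightarrow> nat \<times> bool \<Rightarrow> bool" where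
  "dominates p q \<longleftrightarrow> fst q \<le> fst p \<and> (snd q \<longrightarrow> fst q \<noteq> fst p)"

lemma transp_dominates: "transp dominates"
  by (auto simp: transp_def dominates_def)

lemma is_overpartition_iff:
  "is_overpartition xs n \<longleftrightarrow>
     sorted_wrt dominates xs \<and> (\<forall>p\<in>set xs. fst p > 0) \<and> sum_list (map fst xs) = n"
  unfolding is_overpartition_def sorted_wrt_map sorted_wrt_iff_nth_less dominates_def
  by (auto dest: less_trans) (metis less_trans)+

text \<open>A set suffices, since a list sorted by \<open>dominates\<close> overlines each value at
  most once.\<close>

primrec overlined :: "(nat \<times> bool) list \<Rightarrow> nat set" where
  "overlined [] = {}"
| "overlined (p # xs) = (if snd p then insert (fst p) (overlined xs) else overlined xs)"

primrec non_overlined :: "(nat \<times> bool) list \<Rightarrow> nat multiset" where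
  "non_overlined [] = {#}"
| "non_overlined (p # xs) =
     (if snd p then non_overlined xs else add_mset (fst p) (non_overlined xs))"

lemma finite_overlined [simp]: "finite (overlined xs)"
  by (induction xs) auto

lemma size_non_overlined: "size (non_overlined xs) = num_non_overlined xs"
  by (induction xs) (auto simp: num_non_overlined_def)

lemma parts_eq: "fst ` set xs = overlined xs \<union> set_mset (non_overlined xs)"
  by (induction xs) auto

lemma mem_overlined_iff: "u \<in> overlined xs \<longleftrightarrow> (u, True) \<in> set xs"
  by (induction xs) (auto split: if_splits)

lemma dominates_head:
  assumes "sorted_wrt dominates ((t, b) # xs)"
  shows "t \<notin> overlined xs" and "u \<in> fst ` set xs \<Longrightarrow> u \<le> t"
  using assms by (auto simp: mem_overlined_iff dominates_def)

lemma length_eq_card_overlined: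
  "sorted_wrt dominates xs \<Longrightarrow> length xs = card (overlined xs) + size (non_overlined xs)"
proof (induction xs)
  case (Cons p xs)
  then show ?case using dominates_head(1)[of "fst p" "snd p" xs] by simp
qed simp

lemma sum_list_eq_sum_overlined:
  "sorted_wrt dominates xs \<Longrightarrow>
     sum_list (map fst xs) = \<Sum>(overlined xs) + \<Sum>\<^sub># (non_overlined xs)"
proof (induction xs)
  case (Cons p xs)
  then show ?case using dominates_head(1)[of "fst p" "snd p" xs] by simp
qed simp

text \<open>The head is forced: its value is the largest of all parts, and it is overlined exactly
  when that value lies in the set, because no later part of the same value can be.\<close>

lemma dominates_sorted_unique:
  assumes "sorted_wrt dominates xs" "sorted_wrt dominates ys"
    and "overlined xs = overlined ys" "non_overlined xs = non_overlined ys"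
  shows "xs = ys"
  using assms
proof (induction xs arbitrary: ys)
  case Nil
  then show ?case by (cases ys) (auto split: if_splits)
next
  case (Cons p xs)
  obtain q ys' where ys: "ys = q # ys'"
    using Cons.prems by (cases ys) (auto split: if_splits)
  obtain u b v b' where p: "p = (u, b)" and q: "q = (v, b')" by fastforce
  have "fst ` set (p # xs) = fst ` set (q # ys')"
    using Cons.prems unfolding parts_eq ys by simp
  moreover have "\<forall>x\<in>fst ` set (p # xs). x \<le> u" "\<forall>x\<in>fst ` set (q # ys'). x \<le> v"
    using dominates_head(2)[of u b xs] dominates_head(2)[of v b' ys'] Cons.prems(1,2)
    by (auto simp: p q ys)
  ultimately have uv: "u = v"
    by (metis antisym fst_conv imageI list.set_intros(1) p q)
  have hd: "u \<notin> overlined xs" "u \<notin> overlined ys'"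
    using dominates_head(1)[of u b xs] dominates_head(1)[of v b' ys'] Cons.prems(1,2)
    by (simp_all add: p q ys uv)
  then have bb: "b = b'"
    using Cons.prems(3) by (auto simp: p q ys uv split: if_splits)
  have "overlined xs = overlined ys'" "non_overlined xs = non_overlined ys'"
    using Cons.prems(3,4) hd by (auto simp: p q ys uv bb split: if_splits)
  then show ?case using Cons.IH[of ys'] Cons.prems(1,2) by (simp add: p q ys uv bb)
qed

text \<open>Peel off the largest value, taking its overlined copy first if there is one, since an
  overlined part must precede its equals.\<close>

lemma dominates_sorted_exists:
  assumes "finite V"
  shows "\<exists>xs. sorted_wrt dominates xs \<and> overlined xs = V \<and> non_overlined xs = M"
  using assms
proof (induction "card V + size M" arbitrary: V M rule: less_induct)
  case less
  show ?case
  proof (cases "V \<union> set_mset M = {}")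
    case True
    then show ?thesis by (intro exI[of _ "[]"]) auto
  next
    case False
    define u where "u = Max (V \<union> set_mset M)"
    have u: "u \<in> V \<union> set_mset M" and ub: "\<forall>x\<in>V \<union> set_mset M. x \<le> u"
      using False less.prems unfolding u_def by (auto intro: Max_in simp del: Un_iff)
    show ?thesis
    proof (cases "u \<in> V")
      case True
      then have "card (V - {u}) + size M < card V + size M"
        using less.prems card_Diff1_less[of V u] by simp
      then obtain xs where xs: "sorted_wrt dominates xs" "overlined xs = V - {u}"
        "non_overlined xs = M" using less by fastforce
      have "dominates (u, True) q" if "q \<in> set xs" for q
      proof -
        have "fst q \<in> fst ` set xs" using that by (rule imageI)
        then have "fst q \<in> V \<union> set_mset M" unfolding parts_eq xs(2,3) by blast
        moreover have "fst q \<noteq> u" if "snd q"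
        proof -
          have "q = (fst q, True)" using that by (simp add: prod_eq_iff)
          then have "fst q \<in> overlined xs" using \<open>q \<in> set xs\<close> by (simp add: mem_overlined_iff)
          then show ?thesis by (simp add: xs(2))
        qed
        ultimately show ?thesis using ub by (auto simp: dominates_def)
      qed
      then show ?thesis using xs True by (intro exI[of _ "(u, True) # xs"]) auto
    next
      case False
      then have uM: "u \<in># M" using u by simp
      then have "card V + size (M - {#u#}) < card V + size M"
        by (simp add: size_Diff1_less)
      then obtain xs where xs: "sorted_wrt dominates xs" "overlined xs = V"
        "non_overlined xs = M - {#u#}" using less by fastforce
      have "dominates (u, False) q" if "q \<in> set xs" for q
      proof -
        have "fst q \<in> fst ` set xs" using that by (rule imageI)
        then have "fst q \<in> V \<union> set_mset M" unfolding parts_eq xs(2,3) by (auto dest: in_diffD)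
        moreover have "fst q \<in> V" if "snd q"
        proof -
          have "q = (fst q, True)" using that by (simp add: prod_eq_iff)
          then have "fst q \<in> overlined xs" using \<open>q \<in> set xs\<close> by (simp add: mem_overlined_iff)
          then show ?thesis by (simp add: xs(2))
        qed
        ultimately show ?thesis using ub False by (auto simp: dominates_def)
      qed
      then show ?thesis using xs uM by (intro exI[of _ "(u, False) # xs"]) auto
    qed
  qed
qed

section \<open>Finiteness and the alternating sum for overpartitions\<close>

lemma finite_overpartitions: "finite {xs. is_overpartition xs n}"
proof (rule finite_subset)
  show "{xs. is_overpartition xs n} \<subseteq> {xs. set xs \<subseteq> {1..n} \<times> UNIV \<and> length xs \<le> n}"
  proof safe
    fix xs v b assume "is_overpartition xs n"
    then have pos: "\<forall>p\<in>set xs. fst p > 0" and s: "sum_list (map fst xs) = n"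
      by (auto simp: is_overpartition_def)
    show "length xs \<le> n"
      using pos unfolding s[symmetric] by (induction xs) (auto simp: Suc_le_eq add_mono_thms_linordered_field)
    assume "(v, b) \<in> set xs"
    then show "v \<in> {1..n}"
      using pos member_le_sum_list[of v "map fst xs"] unfolding s by force
  qed auto
  show "finite {xs. set xs \<subseteq> {1..n} \<times> (UNIV :: bool set) \<and> length xs \<le> n}"
    by (rule finite_lists_length_le) auto
qed

lemma num_non_overlined_le:
  "is_overpartition xs n \<Longrightarrow> num_non_overlined xs \<le> n"
proof -
  assume "is_overpartition xs n"
  then have pos: "\<forall>p\<in>set xs. fst p > 0" and s: "sum_list (map fst xs) = n"
    by (auto simp: is_overpartition_def)
  show ?thesis
    using pos unfolding s[symmetric] num_non_overlined_def by (induction xs) auto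
qed


text \<open>Size 0 stands apart because the empty sequence has no first part to toggle; it
  contributes the single term 1.\<close>

lemma alternating_sum_overpartitions:
  assumes sub: "X \<subseteq> {xs. is_overpartition xs n}" and nil: "n = 0 \<Longrightarrow> [] \<in> X"
    and toggle: "\<And>p b xs. (p, b) # xs \<in> X \<Longrightarrow> (p, \<not> b) # xs \<in> X"
  shows "(\<Sum>k\<le>n. (-1) ^ k * int (card {xs \<in> X. num_non_overlined xs = k})) = (if n = 0 then 1 else 0)"
proof (cases "n = 0")
  case True
  have "xs = []" if "is_overpartition xs 0" for xs
    using that by (cases xs) (auto simp: is_overpartition_def)
  then have "X = {[]}" using sub nil True by auto
  then have "{xs \<in> X. num_non_overlined xs = 0} = {[]}" by (auto simp: num_non_overlined_def)
  then show ?thesis using True by simp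
next
  case False
  then have "[] \<notin> X" using sub by (auto simp: is_overpartition_def)
  moreover have "finite X" using sub finite_overpartitions by (rule finite_subset)
  moreover have "num_non_overlined xs \<le> n" if "xs \<in> X" for xs
    using that sub num_non_overlined_le by blast
  ultimately have "(\<Sum>k\<le>n. (-1) ^ k * int (card {xs \<in> X. num_non_overlined xs = k})) = 0"
    using toggle by (intro alternating_sum_toggle_head)
  then show ?thesis using False by simp
qed

lemma is_overpartition_toggle:
  "is_overpartition ((p, b) # xs) n \<Longrightarrow> is_overpartition ((p, b') # xs) n"
  by (auto simp: is_overpartition_iff dominates_def)

lemma beta_eq:
  assumes "c \<in> {1..int N}" "[int u = - c] (mod int N)"
  shows "\<beta> N (- int u) = c"
  unfolding \<beta>_def
proof (rule the_equality)
  have c: "[c = - int u] (mod int N)"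
    using cong_minus_minus_iff[of "int u" "- c" "int N"] assms(2) by (simp add: cong_sym_eq)
  then show "c \<in> {1..int N} \<and> [c = - int u] (mod int N)" using assms(1) by blast
  fix b assume b: "b \<in> {1..int N} \<and> [b = - int u] (mod int N)"
  then have "[b = c] (mod int N)" using c by (metis cong_trans cong_sym)
  \<comment> \<open>Subtracting 1 moves the range from 1 to \<open>N\<close> onto 0 to
    \<open>N - 1\<close>, where congruent numbers are equal.\<close>
  then have "[b - 1 = c - 1] (mod int N)" by (simp add: cong_diff)
  then show "b = c" using cong_less_imp_eq_int[of "b - 1" "int N" "c - 1"] b assms(1) by auto
qed

subsection \<open>Words of index sets\<close>

text \<open>
  Words list the index sets from the largest part to the smallest.  \<open>offset ws\<close> is the least
  possible \<open>j\<close> for the first part \<open>N j - \<Sum>S\<close> of a sequence with word \<open>ws\<close> and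
  no overlined parts.
\<close>

fun offset :: "nat set list \<Rightarrow> nat" where
  "offset [] = 0"
| "offset [S] = card S"
| "offset (S # T # ws) = card S - 1 + (if Max T < Min S then 1 else 0) + offset (T # ws)"

text \<open>The least possible total of the multiples \<open>j\<close> over all parts of a sequence
  with this word and no overlined parts.\<close>

primrec total_offset :: "nat set list \<Rightarrow> nat" where
  "total_offset [] = 0"
| "total_offset (S # ws) = offset (S # ws) + total_offset ws"

text \<open>At least two colours force every \<open>a i\<close> strictly below \<open>N\<close>, so
  that \<open>N - a i\<close> is a positive part. The case of one colour is treated separately at
  the end.\<close>

locale superincreasing =
  fixes r N :: nat and a :: "nat \<Rightarrow> int"
  assumes superinc: "j \<in> {1..r} \<Longrightarrow> (\<Sum>i=1..<j. a i) < a j"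
    and sum_le: "(\<Sum>i=1..r. a i) \<le> int N"
    and inj_sums: "inj_on (\<lambda>S. \<Sum>S) {S. S \<subseteq> a ` {1..r} \<and> S \<noteq> {}}"
    and two_le: "2 \<le> r"
begin

definition subset_sum :: "nat set \<Rightarrow> int" where
  "subset_sum S = (\<Sum>i\<in>S. a i)"

definition letters :: "nat set set" where
  "letters = {S. S \<subseteq> {1..r} \<and> S \<noteq> {}}"

text \<open>As \<open>0 < a i < N\<close>, this is the smallest positive integer congruent to
  \<open>- a i\<close>; it is the size removed in the recurrence.\<close>

definition least_part :: "nat \<Rightarrow> nat" where
  "least_part i = nat (int N - a i)"

lemma a_pos: "i \<in> {1..r} \<Longrightarrow> 0 < a i"
proof (induction i rule: less_induct)
  case (less i)
  have "0 \<le> (\<Sum>j=1..<i. a j)" using less by (intro sum_nonneg) (simp add: less_imp_le)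
  then show ?case using superinc[OF less.prems] by simp
qed

lemma subset_sum_mono: "S \<subseteq> T \<Longrightarrow> T \<subseteq> {1..r} \<Longrightarrow> subset_sum S \<le> subset_sum T"
  unfolding subset_sum_def
  using a_pos by (intro sum_mono2) (auto intro: finite_subset[of T "{1..r}"] simp: subset_iff less_imp_le)

lemma subset_sum_le: "S \<subseteq> {1..r} \<Longrightarrow> subset_sum S \<le> int N"
  using subset_sum_mono[of S "{1..r}"] sum_le by (simp add: subset_sum_def)

lemma le_subset_sum: "i \<in> S \<Longrightarrow> S \<subseteq> {1..r} \<Longrightarrow> a i \<le> subset_sum S"
  using subset_sum_mono[of "{i}" S] by (simp add: subset_sum_def)

text \<open>Superincrease extended from initial segments to arbitrary sets of smaller indices. It
  decides the sign of the critical term in \<open>step_iff\<close>.\<close>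

lemma subset_sum_less:
  assumes "j \<in> {1..r}" "\<forall>i\<in>S. i < j" "S \<subseteq> {1..r}"
  shows "subset_sum S < a j"
proof -
  have "subset_sum S \<le> subset_sum {1..<j}"
    by (rule subset_sum_mono) (use assms in auto)
  then show ?thesis using superinc[OF assms(1)] by (simp add: subset_sum_def)
qed

lemma a_mono: "i < j \<Longrightarrow> i \<in> {1..r} \<Longrightarrow> j \<in> {1..r} \<Longrightarrow> a i < a j"
  using subset_sum_less[of j "{i}"] by (simp add: subset_sum_def)

lemma inj_on_a: "inj_on a {1..r}"
  by (rule linorder_inj_onI') (metis a_mono less_irrefl)

lemma a_less: "i \<in> {1..r} \<Longrightarrow> a i < int N"
proof -
  assume i: "i \<in> {1..r}"
  \<comment> \<open>A second colour: its positive value separates \<open>a i\<close> from the bound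
    \<open>N\<close>.\<close>
  define j where "j = (if i = 1 then 2 else 1::nat)"
  have j: "j \<in> {1..r}" "j \<noteq> i" using two_le by (auto simp: j_def)
  have "subset_sum {i, j} \<le> int N" using i j by (intro subset_sum_le) auto
  then show ?thesis using a_pos[OF j(1)] j(2) by (simp add: subset_sum_def)
qed

lemma N_pos: "N > 0"
  using a_less[of 1] a_pos[of 1] two_le by simp

lemma int_least_part: "i \<in> {1..r} \<Longrightarrow> int (least_part i) = int N - a i"
  using a_less[of i] by (simp add: least_part_def)

lemma least_part_pos: "i \<in> {1..r} \<Longrightarrow> least_part i > 0"
  using a_less[of i] by (simp add: least_part_def)

section \<open>Letters, and offsets under changes of the last letter\<close>

lemma finite_letter: "S \<in> letters \<Longrightarrow> finite S"
  unfolding letters_def by (auto intro: finite_subset)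

lemma letter_Min_in: "S \<in> letters \<Longrightarrow> Min S \<in> {1..r}"
  using finite_letter[of S] Min_in[of S] unfolding letters_def by blast

lemma card_letter_pos: "S \<in> letters \<Longrightarrow> card S \<ge> 1"
  using finite_letter[of S] by (simp add: letters_def Suc_le_eq card_gt_0_iff)

text \<open>As last letter \<open>S\<close> counts \<open>card S\<close>; in front of
  \<open>{m}\<close> it counts \<open>card S - 1\<close>, and the new letter supplies the missing
  1.\<close>

lemma offset_snoc_low:
  assumes "set ws \<subseteq> letters" "ws \<noteq> []" "Min (last ws) \<le> m"
  shows "offset (ws @ [{m}]) = offset ws"
  using assms by (induction ws rule: offset.induct) (auto dest: card_letter_pos)

lemma offset_snoc_high:
  assumes "set ws \<subseteq> letters" "ws \<noteq> []" "m < Min (last ws)"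
  shows "offset (ws @ [{m}]) = offset ws + 1"
  using assms by (induction ws rule: offset.induct) (auto dest: card_letter_pos)

text \<open>The maximum of the last letter is unchanged, so the comparison with the preceding letter
  is unaffected and only the cardinality grows.\<close>

lemma offset_snoc_insert:
  assumes "S \<in> letters" "m < Min S"
  shows "offset (ws @ [insert m S]) = offset (ws @ [S]) + 1"
proof -
  have S: "finite S" "S \<noteq> {}" "m \<notin> S"
    using assms finite_letter by (auto simp: letters_def dest: Min_le)
  have "m < Max S" using assms(2) S by (meson Max_in Min_le less_le_trans)
  then have "Max (insert m S) = Max S" using S by simp
  then show ?thesis
    using S by (induction ws rule: offset.induct) auto
qed

lemma offset_ge_1: "set ws \<subseteq> letters \<Longrightarrow> ws \<noteq> [] \<Longrightarrow> offset ws \<ge> 1"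
  by (induction ws rule: offset.induct) (auto dest: card_letter_pos)

lemma total_offset_snoc_low:
  assumes "set ws \<subseteq> letters" "ws = [] \<or> Min (last ws) \<le> m"
  shows "total_offset (ws @ [{m}]) = total_offset ws + 1"
  using assms
proof (induction ws)
  case (Cons S ws)
  then show ?case using offset_snoc_low[of "S # ws" m] by (cases "ws = []") auto
qed simp

text \<open>Every nonempty suffix of \<open>ws\<close> gains 1, and the new letter alone contributes
  another 1.\<close>

lemma total_offset_snoc_high:
  assumes "set ws \<subseteq> letters" "ws \<noteq> []" "m < Min (last ws)"
  shows "total_offset (ws @ [{m}]) = total_offset ws + length ws + 1"
  using assms
proof (induction ws)
  case (Cons S ws)
  then show ?case using offset_snoc_high[of "S # ws" m] by (cases "ws = []") auto
qed simp

lemma total_offset_snoc_insert: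
  assumes "S \<in> letters" "m < Min S"
  shows "total_offset (ws @ [insert m S]) = total_offset (ws @ [S]) + length ws + 1"
proof (induction ws)
  case Nil
  show ?case using offset_snoc_insert[OF assms, of "[]"] by simp
next
  case (Cons T ws)
  then show ?case using offset_snoc_insert[OF assms, of "T # ws"] by simp
qed

text \<open>Each nonempty suffix has offset at least 1 and each letter sums to at most
  \<open>N\<close>. Hence weights are non-negative.\<close>

lemma subset_sums_le_total_offset:
  assumes "set ws \<subseteq> letters"
  shows "(\<Sum>S\<leftarrow>ws. subset_sum S) \<le> int N * int (total_offset ws)"
  using assms
proof (induction ws)
  case (Cons S ws)
  have "subset_sum S \<le> int N * 1"
    using Cons.prems subset_sum_le by (auto simp: letters_def)
  also have "\<dots> \<le> int N * int (offset (S # ws))"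
    using offset_ge_1[OF Cons.prems] by (intro mult_left_mono) auto
  finally show ?case using Cons by (simp add: algebra_simps)
qed simp

section \<open>Words with excesses, and the relation at \<open>m = 0\<close>\<close>

definition weight :: "nat set list \<Rightarrow> nat set \<Rightarrow> nat multiset \<Rightarrow> int" where
  "weight ws Q M = int N * int (total_offset ws + \<Sum>Q + \<Sum>\<^sub># M) - (\<Sum>S\<leftarrow>ws. subset_sum S)"

text \<open>\<open>Q\<close> and \<open>M\<close> hold the overlined and non-overlined excesses of
  the \<open>j\<close>'s over their minimal values, so \<open>weight\<close> is the sum of the parts
  \<open>N j - subset_sum S\<close>. An overlined excess precedes its equals, so
  \<open>0 \<in># M\<close> says that the smallest part is non-overlined with excess 0. The last
  clause forbids this when the last letter has minimum above \<open>m\<close>: always for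
  \<open>m = 0\<close>, never for \<open>m = r\<close>.\<close>

definition words :: "nat \<Rightarrow> nat \<Rightarrow> nat \<Rightarrow> (nat set list \<times> nat set \<times> nat multiset) set" where
  "words m k n = {(ws, Q, M). set ws \<subseteq> letters \<and> finite Q \<and> card Q + size M = length ws \<and>
     size M = k \<and> weight ws Q M = int n \<and> \<not> (ws \<noteq> [] \<and> m < Min (last ws) \<and> 0 \<in># M)}"

lemma image_mset_Suc_pred: "0 \<notin># M \<Longrightarrow> image_mset Suc (image_mset (\<lambda>x. x - Suc 0) M) = M"
  by (induction M) auto

lemma image_mset_pred_Suc: "image_mset (\<lambda>x. x - Suc 0) (image_mset Suc M) = M"
  by (induction M) auto

lemma words_zero_notin:
  assumes "(ws, Q, M) \<in> words 0 k n"
  shows "0 \<notin># M"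
proof (cases "ws = []")
  case True
  then show ?thesis using assms by (simp add: words_def)
next
  case False
  then have "Min (last ws) \<in> {1..r}"
    using assms by (intro letter_Min_in) (auto simp: words_def)
  then show ?thesis using assms False by (simp add: words_def)
qed

lemma sum_mset_Suc: "\<Sum>\<^sub># (image_mset Suc M) = \<Sum>\<^sub># M + size M"
  by (induction M) auto

lemma sum_image_Suc: "finite Q \<Longrightarrow> \<Sum>(Suc ` Q) = \<Sum>Q + card Q"
  by (induction Q rule: finite_induct) (auto simp: image_iff)

lemma weight_Suc:
  "weight ws Q (image_mset Suc M) = weight ws Q M + int N * int (size M)"
  by (simp add: weight_def sum_mset_Suc algebra_simps)

text \<open>At \<open>m = 0\<close> all non-overlined excesses are positive, so each can be lowered
  by 1, which takes \<open>N\<close> off the weight. For the same reason the weight is at least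
  \<open>N * k\<close>, so nothing is counted when \<open>N * k > n\<close>.\<close>

lemma words_zero: "card (words 0 k n) = (if N * k \<le> n then card (words r k (n - N * k)) else 0)"
proof (cases "N * k \<le> n")
  case True
  let ?f = "\<lambda>(ws :: nat set list, Q :: nat set, M). (ws, Q, image_mset Suc M)"
  let ?g = "\<lambda>(ws :: nat set list, Q :: nat set, M). (ws, Q, image_mset (\<lambda>x. x - Suc 0) M)"
  have n: "int (n - N * k) = int n - int N * int k" using True by (simp add: of_nat_diff)
  have "bij_betw ?f (words r k (n - N * k)) (words 0 k n)"
  proof (rule bij_betw_byWitness[where f' = ?g])
    show "\<forall>x\<in>words r k (n - N * k). ?g (?f x) = x"
    proof
      fix x :: "nat set list \<times> nat set \<times> nat multiset"
      obtain ws Q M where "x = (ws, Q, M)" by (rule prod_cases3)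
      then show "?g (?f x) = x" by (simp only: image_mset_pred_Suc split)
    qed
    show "\<forall>x\<in>words 0 k n. ?f (?g x) = x"
    proof
      fix x assume x: "x \<in> words 0 k n"
      obtain ws Q M where "x = (ws, Q, M)" by (rule prod_cases3)
      then show "?f (?g x) = x"
        using image_mset_Suc_pred[OF words_zero_notin[of ws Q M k n]] x by (simp only: split)
    qed
    show "?f ` words r k (n - N * k) \<subseteq> words 0 k n"
    proof
      fix y assume "y \<in> ?f ` words r k (n - N * k)"
      then obtain ws Q M where x: "(ws, Q, M) \<in> words r k (n - N * k)"
        and y: "y = (ws, Q, image_mset Suc M)" by auto
      have "weight ws Q (image_mset Suc M) = int n"
        using x n unfolding words_def weight_Suc by simp
      then show "y \<in> words 0 k n" using x by (simp add: y words_def)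
    qed
    show "?g ` words 0 k n \<subseteq> words r k (n - N * k)"
    proof
      fix y assume "y \<in> ?g ` words 0 k n"
      then obtain ws Q M where x: "(ws, Q, M) \<in> words 0 k n"
        and y: "y = (ws, Q, image_mset (\<lambda>x. x - Suc 0) M)" by auto
      define M' where "M' = image_mset (\<lambda>x. x - Suc 0) M"
      have M: "M = image_mset Suc M'"
        using image_mset_Suc_pred[OF words_zero_notin[OF x]] by (simp add: M'_def)
      have "\<not> r < Min (last ws)" if "ws \<noteq> []"
      proof -
        have "last ws \<in> letters" using x that by (auto simp: words_def)
        then show ?thesis using letter_Min_in by fastforce
      qed
      then have "(ws, Q, M') \<in> words r k (n - N * k)"
        using x n unfolding M words_def by (auto simp: weight_Suc)
      then show "y \<in> words r k (n - N * k)" by (simp add: y M'_def)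
    qed
  qed
  then show ?thesis using True by (simp add: bij_betw_same_card)
next
  case False
  have "words 0 k n = {}"
  proof safe
    fix ws Q M assume x: "(ws, Q, M) \<in> words 0 k n"
    have "size M \<le> \<Sum>\<^sub># M" using words_zero_notin[OF x] by (induction M) auto
    then have "k \<le> \<Sum>\<^sub># M" using x by (simp add: words_def)
    then have "int N * int k \<le> int N * int (\<Sum>\<^sub># M)"
      by (intro mult_left_mono of_nat_mono) auto
    also have "\<dots> \<le> int N * int (\<Sum>Q + \<Sum>\<^sub># M)"
      by (intro mult_left_mono of_nat_mono) auto
    also have "\<dots> \<le> weight ws Q M"
      using x subset_sums_le_total_offset[of ws]
      by (simp add: words_def weight_def distrib_left)
    finally have "int (N * k) \<le> int n" using x by (simp add: words_def)
    then show "(ws, Q, M) \<in> {}" using False by linarith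
  qed
  then show ?thesis using False by simp
qed

text \<open>For positive \<open>m\<close>, what \<open>words m\<close> contains beyond
  \<open>words (m - 1)\<close>.\<close>

definition ending :: "nat \<Rightarrow> nat \<Rightarrow> nat \<Rightarrow> (nat set list \<times> nat set \<times> nat multiset) set" where
  "ending m k n = {(ws, Q, M). set ws \<subseteq> letters \<and> finite Q \<and> card Q + size M = length ws \<and>
     size M = k \<and> weight ws Q M = int n \<and> ws \<noteq> [] \<and> Min (last ws) = m \<and> 0 \<in># M}"

lemma weight_nonneg: "set ws \<subseteq> letters \<Longrightarrow> 0 \<le> weight ws Q M"
  using subset_sums_le_total_offset[of ws]
    mult_left_mono[of "int (total_offset ws)" "int (total_offset ws + \<Sum>Q + \<Sum>\<^sub># M)" "int N"]
  by (simp add: weight_def del: of_nat_add of_nat_sum)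

lemma singleton_letter: "m \<in> {1..r} \<Longrightarrow> {m} \<in> letters"
  by (simp add: letters_def)

lemma insert_letter: "m \<in> {1..r} \<Longrightarrow> S \<in> letters \<Longrightarrow> insert m S \<in> letters"
  by (simp add: letters_def)

lemma Min_insert_letter: "S \<in> letters \<Longrightarrow> m < Min S \<Longrightarrow> Min (insert m S) = m"
  using finite_letter[of S] by (auto simp: letters_def)

lemma less_Min_notin: "S \<in> letters \<Longrightarrow> m < Min S \<Longrightarrow> m \<notin> S"
  using finite_letter[of S] by (auto dest: Min_le)

section \<open>Removing a minimal non-overlined smallest part\<close>

context
  fixes m :: nat
  assumes m: "m \<in> {1..r}"
begin

lemma weight_snoc_low:
  assumes "set ws \<subseteq> letters" "ws = [] \<or> Min (last ws) \<le> m"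
  shows "weight (ws @ [{m}]) Q (add_mset 0 M) = weight ws Q M + int (least_part m)"
  using total_offset_snoc_low[OF assms] int_least_part[OF m]
  by (simp add: weight_def subset_sum_def algebra_simps)

text \<open>Appending \<open>{m}\<close> raises the offsets of all \<open>length ws\<close> suffixes
  of \<open>ws\<close>; the equally many excesses on the right are raised by 1 to match.\<close>

lemma weight_snoc_high:
  assumes "set ws \<subseteq> letters" "ws \<noteq> []" "m < Min (last ws)" "finite Q"
    "card Q + size M = length ws"
  shows "weight (ws @ [{m}]) Q (add_mset 0 M) =
    weight ws (Suc ` Q) (image_mset Suc M) + int (least_part m)"
  using total_offset_snoc_high[OF assms(1-3)] int_least_part[OF m]
  by (simp add: weight_def subset_sum_def sum_mset_Suc sum_image_Suc[OF assms(4)] assms(5)[symmetric]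
      algebra_simps)

text \<open>Dropping \<open>m\<close> from the last letter lowers the total offset by
  \<open>length ws + 1\<close>, while raising \<open>length ws\<close> excesses returns all but one
  of these units. The net change is \<open>N - a m\<close>.\<close>

lemma weight_snoc_insert:
  assumes S: "S \<in> letters" "m < Min S" and "finite Q" "card Q + size M = length ws"
  shows "weight (ws @ [insert m S]) Q (add_mset 0 M) =
    weight (ws @ [S]) (insert 0 (Suc ` Q)) (image_mset Suc M) + int (least_part m)"
proof -
  have "\<Sum>(insert 0 (Suc ` Q)) = \<Sum>Q + card Q"
    using assms(3) by (simp add: sum_image_Suc)
  moreover have "subset_sum (insert m S) = a m + subset_sum S"
    using less_Min_notin[OF S] finite_letter[OF S(1)] by (simp add: subset_sum_def)
  ultimately show ?thesis
    using total_offset_snoc_insert[OF S] int_least_part[OF m]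
    by (simp add: weight_def sum_mset_Suc assms(4)[symmetric] algebra_simps)
qed

text \<open>
  Removal of a smallest part that is non-overlined and minimal.  Dropping \<open>{m}\<close> below a
  letter with minimum above \<open>m\<close> lowers every offset by 1, which raising all excesses by 1
  compensates.  A letter \<open>insert m S\<close> leaves \<open>S\<close> behind, with an overlined excess 0
  to keep the length.
\<close>

lemma ending_snoc_low:
  assumes "ws = [] \<or> Min (last ws) \<le> m"
  shows "(ws @ [{m}], Q, add_mset 0 M) \<in> ending m (Suc k) (n + least_part m) \<longleftrightarrow>
    (ws, Q, M) \<in> words m k n"
  using assms weight_snoc_low[of ws Q M] singleton_letter[OF m]
  by (auto simp: ending_def words_def)

lemma ending_snoc_high:
  assumes "ws \<noteq> []" "m < Min (last ws)"
  shows "(ws @ [{m}], Q, add_mset 0 M) \<in> ending m (Suc k) (n + least_part m) \<longleftrightarrow>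
    (ws, Suc ` Q, image_mset Suc M) \<in> words m k n"
  using assms weight_snoc_high[of ws Q M] singleton_letter[OF m]
  by (auto simp: ending_def words_def card_image finite_image_iff)

lemma ending_snoc_insert:
  assumes S: "S \<in> letters" "m < Min S"
  shows "(ws @ [insert m S], Q, add_mset 0 M) \<in> ending m (Suc k) (n + least_part m) \<longleftrightarrow>
    (ws @ [S], insert 0 (Suc ` Q), image_mset Suc M) \<in> words m k n"
  using assms weight_snoc_insert[OF S, of Q M ws] insert_letter[OF m S(1)]
    Min_insert_letter[OF S]
  by (auto simp: ending_def words_def card_image finite_image_iff image_iff)

lemma ending_cases:
  assumes "(us, Q, M0) \<in> ending m k n"
  obtains (low) ws M where "us = ws @ [{m}]" "M0 = add_mset 0 M" "ws = [] \<or> Min (last ws) \<le> m"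
    | (high) ws M where "us = ws @ [{m}]" "M0 = add_mset 0 M" "ws \<noteq> []" "m < Min (last ws)"
    | (insert) ws S M where "us = ws @ [insert m S]" "M0 = add_mset 0 M" "S \<in> letters" "m < Min S"
proof -
  have "us \<noteq> []" "0 \<in># M0" using assms by (auto simp: ending_def)
  then obtain ws U M where us: "us = ws @ [U]" and M: "M0 = add_mset 0 M"
    by (metis append_butlast_last_id multi_member_split)
  have U: "U \<in> letters" "Min U = m" using assms by (auto simp: us ending_def)
  have fin: "finite U" "m \<in> U" and ge: "\<forall>x\<in>U. m \<le> x"
    using U finite_letter[OF U(1)] Min_in[of U] by (auto simp: letters_def)
  show thesis
  proof (cases "U = {m}")
    case True
    then have "us = ws @ [{m}]" using us by simp
    then show thesis
      using low[OF _ M, of ws] high[OF _ M, of ws] by (meson not_le)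
  next
    case False
    define S where "S = U - {m}"
    have S: "finite S" "S \<noteq> {}" "U = insert m S"
      using fin False unfolding S_def by blast+
    have "S \<in> letters" using S(2) U(1) by (auto simp: S_def letters_def)
    moreover have "m < Min S"
      using Min_in[OF S(1,2)] ge by (auto simp: S_def order.strict_iff_order)
    ultimately show thesis using insert[of ws S M] us M S(3) by simp
  qed
qed

text \<open>The three kinds of results of a removal are told apart by the last letter and by
  \<open>0 \<in> P\<close>. If its minimum exceeds \<open>m\<close>, then
  \<open>0 \<notin># M\<close>, so \<open>M\<close> is a shift by 1, and \<open>P\<close> contains 0
  exactly when an overlined excess 0 was put in.\<close>

lemma words_cases:
  assumes "(us, P, M) \<in> words m k n"
  obtains (low) "us = [] \<or> Min (last us) \<le> m"
    | (high) Q L where "us \<noteq> []" "m < Min (last us)" "P = Suc ` Q" "M = image_mset Suc L"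
    | (insert) ws S Q L where "us = ws @ [S]" "S \<in> letters" "m < Min S" "P = insert 0 (Suc ` Q)"
      "M = image_mset Suc L"
proof (cases "us = [] \<or> Min (last us) \<le> m")
  case False
  then obtain ws S where us: "us = ws @ [S]" by (metis append_butlast_last_id)
  have "0 \<notin># M" using assms False by (auto simp: words_def)
  then obtain L where L: "M = image_mset Suc L" by (metis image_mset_Suc_pred)
  have S: "S \<in> letters" using assms us by (auto simp: words_def)
  have P: "Suc ` (Suc -` P) = P - {0}"
    by (auto simp: image_vimage_eq gr0_conv_Suc)
  show thesis
  proof (cases "0 \<in> P")
    case zero: True
    then have "P = insert 0 (Suc ` (Suc -` P))" using P by blast
    moreover have "m < Min S" using us False by simp
    ultimately show thesis using insert[OF us S _ _ L] by blast
  next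
    case zero: False
    then have "P = Suc ` (Suc -` P)" using P by blast
    moreover have "us \<noteq> []" "m < Min (last us)" using False by auto
    ultimately show thesis using high[OF _ _ _ L] by blast
  qed
qed (rule low)

lemma card_ending: "card (ending m (Suc k) (n + least_part m)) = card (words m k n)"
proof -
  \<comment> \<open>The branches are the cases \<open>insert\<close>, \<open>low\<close> and
    \<open>high\<close> of \<open>ending_cases\<close>.\<close>
  define down where "down = (\<lambda>(us, Q, M). let ws = butlast us; L = M - {#0::nat#} in
    if last us \<noteq> {m} then (ws @ [last us - {m}], insert 0 (Suc ` Q), image_mset Suc L)
    else if ws = [] \<or> Min (last ws) \<le> m then (ws, Q, L)
    else (ws, Suc ` Q, image_mset Suc L))"
  \<comment> \<open>The branches are the cases \<open>low\<close>, \<open>insert\<close> and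
    \<open>high\<close> of \<open>words_cases\<close>.\<close>
  define up where "up = (\<lambda>(us, P, M). let L = image_mset (\<lambda>x. x - Suc 0) M in
    if us = [] \<or> Min (last us) \<le> m then (us @ [{m}], P, add_mset (0::nat) M)
    else if 0 \<in> P then (butlast us @ [insert m (last us)], Suc -` P, add_mset 0 L)
    else (us @ [{m}], Suc -` P, add_mset 0 L))"
  have vimage: "Suc -` (Suc ` Q) = Q" "Suc -` (insert 0 (Suc ` Q)) = Q" for Q by auto
  have down: "down (ws @ [{m}], Q, add_mset 0 M) = (ws, Q, M)"
    and up: "up (ws, Q, M) = (ws @ [{m}], Q, add_mset 0 M)"
    if "ws = [] \<or> Min (last ws) \<le> m" for ws Q M
    using that by (simp_all add: down_def up_def)
  have down_high: "down (ws @ [{m}], Q, add_mset 0 M) = (ws, Suc ` Q, image_mset Suc M)"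
    and up_high: "up (ws, Suc ` Q, image_mset Suc M) = (ws @ [{m}], Q, add_mset 0 M)"
    if "ws \<noteq> []" "m < Min (last ws)" for ws Q M
    using that by (auto simp: down_def up_def vimage image_mset_pred_Suc)
  have down_insert: "down (ws @ [insert m S], Q, add_mset 0 M)
        = (ws @ [S], insert 0 (Suc ` Q), image_mset Suc M)"
    and up_insert: "up (ws @ [S], insert 0 (Suc ` Q), image_mset Suc M)
        = (ws @ [insert m S], Q, add_mset 0 M)"
    if S: "S \<in> letters" "m < Min S" for ws S Q M
  proof -
    have "insert m S \<noteq> {m}" "insert m S - {m} = S"
      using less_Min_notin[OF S] S(1) by (auto simp: letters_def)
    then show "down (ws @ [insert m S], Q, add_mset 0 M)
        = (ws @ [S], insert 0 (Suc ` Q), image_mset Suc M)"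
      by (simp add: down_def)
    show "up (ws @ [S], insert 0 (Suc ` Q), image_mset Suc M)
        = (ws @ [insert m S], Q, add_mset 0 M)"
      using S(2) by (simp add: up_def vimage image_mset_pred_Suc)
  qed
  have "bij_betw down (ending m (Suc k) (n + least_part m)) (words m k n)"
  proof (rule bij_betw_byWitness[where f' = up])
    show "\<forall>z\<in>ending m (Suc k) (n + least_part m). up (down z) = z"
    proof safe
      fix us Q M assume "(us, Q, M) \<in> ending m (Suc k) (n + least_part m)"
      then show "up (down (us, Q, M)) = (us, Q, M)"
        by (cases rule: ending_cases)
          (simp_all only: simp_thms down up down_high up_high down_insert up_insert)
    qed
    show "\<forall>z\<in>words m k n. down (up z) = z"
    proof safe
      fix us Q M assume "(us, Q, M) \<in> words m k n"
      then show "down (up (us, Q, M)) = (us, Q, M)"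
        by (cases rule: words_cases)
          (simp_all only: simp_thms down up down_high up_high down_insert up_insert)
    qed
    show "down ` ending m (Suc k) (n + least_part m) \<subseteq> words m k n"
    proof (rule image_subsetI, safe)
      fix us Q M
      assume z: "(us, Q, M) \<in> ending m (Suc k) (n + least_part m)"
      then show "down (us, Q, M) \<in> words m k n"
        by (cases rule: ending_cases)
          (use z in \<open>simp_all only: simp_thms down down_high down_insert
             ending_snoc_low ending_snoc_high ending_snoc_insert\<close>)
    qed
    show "up ` words m k n \<subseteq> ending m (Suc k) (n + least_part m)"
    proof (rule image_subsetI, safe)
      fix us Q M
      assume z: "(us, Q, M) \<in> words m k n"
      then show "up (us, Q, M) \<in> ending m (Suc k) (n + least_part m)"
        by (cases rule: words_cases)
          (use z in \<open>simp_all only: simp_thms up up_high up_insert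
             ending_snoc_low ending_snoc_high ending_snoc_insert\<close>)
    qed
  qed
  then show ?thesis by (rule bij_betw_same_card)
qed

text \<open>The object left after the removal still has non-negative weight, so the removed size is
  at most \<open>n\<close>. This accounts for the zero branch of the recurrence.\<close>

lemma ending_bounds:
  assumes "(us, Q, M) \<in> ending m k n"
  shows "k > 0" "least_part m \<le> n"
proof -
  have z: "set us \<subseteq> letters" "finite Q" "card Q + size M = length us" "weight us Q M = int n"
    "size M = k" "0 \<in># M"
    using assms by (auto simp: ending_def)
  show "k > 0" using z(5,6) by (metis gr0I size_eq_0_iff_empty empty_iff set_mset_empty)
  show "least_part m \<le> n"
    using assms
  proof (cases rule: ending_cases)
    case (low ws L)
    then have "weight us Q M = weight ws Q L + int (least_part m)"
      using z(1) by (simp add: weight_snoc_low)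
    moreover have "0 \<le> weight ws Q L" using z(1) low by (intro weight_nonneg) auto
    ultimately show ?thesis using z(4) by simp
  next
    case (high ws L)
    then have "weight us Q M = weight ws (Suc ` Q) (image_mset Suc L) + int (least_part m)"
      using z(1-3) by (simp add: weight_snoc_high)
    moreover have "0 \<le> weight ws (Suc ` Q) (image_mset Suc L)"
      using z(1) high by (intro weight_nonneg) auto
    ultimately show ?thesis using z(4) by simp
  next
    case (insert ws S L)
    then have "weight us Q M =
        weight (ws @ [S]) (insert 0 (Suc ` Q)) (image_mset Suc L) + int (least_part m)"
      using z(1-3) by (simp add: weight_snoc_insert)
    moreover have "0 \<le> weight (ws @ [S]) (insert 0 (Suc ` Q)) (image_mset Suc L)"
      using z(1) insert by (intro weight_nonneg) auto
    ultimately show ?thesis using z(4) by simp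
  qed
qed

end

lemma words_Suc:
  assumes "m < r" "finite (words (Suc m) k n)"
  shows "card (words (Suc m) k n) = card (words m k n) +
    (if 0 < k \<and> least_part (Suc m) \<le> n
     then card (words (Suc m) (k - 1) (n - least_part (Suc m))) else 0)"
proof -
  have m: "Suc m \<in> {1..r}" using assms(1) by simp
  have eq: "words (Suc m) k n = words m k n \<union> ending (Suc m) k n"
    by (auto simp: words_def ending_def)
  have "words m k n \<inter> ending (Suc m) k n = {}"
    by (auto simp: words_def ending_def)
  then have "card (words (Suc m) k n) = card (words m k n) + card (ending (Suc m) k n)"
    using assms(2) unfolding eq by (simp add: card_Un_disjoint)
  moreover have "card (ending (Suc m) k n) = (if 0 < k \<and> least_part (Suc m) \<le> n
     then card (words (Suc m) (k - 1) (n - least_part (Suc m))) else 0)"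
  proof (cases "0 < k \<and> least_part (Suc m) \<le> n")
    case True
    then show ?thesis
      using card_ending[OF m, of "k - 1" "n - least_part (Suc m)"] by simp
  next
    case False
    then have "ending (Suc m) k n = {}" by (auto dest: ending_bounds[OF m])
    then show ?thesis using False by auto
  qed
  ultimately show ?thesis by simp
qed

subsection \<open>Overpartitions with difference conditions as words\<close>

lemma inj_on_a_subset: "S \<subseteq> {1..r} \<Longrightarrow> inj_on a S"
  by (rule inj_on_subset[OF inj_on_a])

lemma sum_image_a: "S \<subseteq> {1..r} \<Longrightarrow> \<Sum>(a ` S) = subset_sum S"
  unfolding subset_sum_def by (simp only: sum.reindex[OF inj_on_a_subset] comp_def)

text \<open>Distinctness of the subset sums makes the definite description pick out the image of
  \<open>S\<close>.\<close>

lemma defining_subset_eq: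
  assumes "S \<in> letters"
  shows "defining_subset (a ` {1..r}) (subset_sum S) = a ` S"
  unfolding defining_subset_def
proof (rule the_equality)
  show S: "a ` S \<subseteq> a ` {1..r} \<and> a ` S \<noteq> {} \<and> \<Sum>(a ` S) = subset_sum S"
    using assms sum_image_a[of S] by (auto simp: letters_def)
  show "T = a ` S" if "T \<subseteq> a ` {1..r} \<and> T \<noteq> {} \<and> \<Sum>T = subset_sum S" for T
    using inj_onD[OF inj_sums, of T "a ` S"] that S by simp
qed

lemma w_eq:
  assumes "S \<in> letters"
  shows "w (a ` {1..r}) (subset_sum S) = card S"
  unfolding w_def defining_subset_eq[OF assms]
  using assms by (intro card_image inj_on_a_subset) (simp add: letters_def)

lemma v_eq:
  assumes "S \<in> letters"
  shows "v (a ` {1..r}) (subset_sum S) = a (Min S)"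
proof -
  have "a (Min S) \<le> a i" if "i \<in> S" for i
  proof -
    have "Min S \<le> i" using that finite_letter[OF assms] by simp
    moreover have "i \<in> {1..r}" using that assms by (auto simp: letters_def)
    ultimately show ?thesis
      using a_mono[of "Min S" i] letter_Min_in[OF assms] by (cases "Min S = i") auto
  qed
  then show ?thesis
    unfolding v_def defining_subset_eq[OF assms]
    using assms finite_letter[OF assms] by (intro Min_eqI) (auto simp: letters_def)
qed

text \<open>Numbers in this range are their own least positive residues, which lets
  \<open>\<beta>\<close> recover the sum from a part.\<close>

lemma subset_sum_bounds: "S \<in> letters \<Longrightarrow> subset_sum S \<in> {1..int N}"
  using subset_sum_le[of S] le_subset_sum[of "Min S" S] a_pos[of "Min S"] letter_Min_in[of S]
    Min_in[of S] finite_letter[of S] by (auto simp: letters_def)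

lemma beta_part:
  assumes "S \<in> letters" "int u = int N * j - subset_sum S"
  shows "\<beta> N (- int u) = subset_sum S"
  using assms subset_sum_bounds by (intro beta_eq) (auto simp: cong_iff_dvd_diff)

lemma subset_sum_inj: "S \<in> letters \<Longrightarrow> T \<in> letters \<Longrightarrow> subset_sum S = subset_sum T \<Longrightarrow> S = T"
  using defining_subset_eq[of S] defining_subset_eq[of T] inj_on_image_eq_iff[OF inj_on_a, of S T]
  by (simp add: letters_def)

lemma subset_sums_eq: "subset_sums (a ` {1..r}) = subset_sum ` letters"
proof -
  have "subset_sums (a ` {1..r}) = Sum ` {S. S \<subseteq> a ` {1..r} \<and> S \<noteq> {}}"
    unfolding subset_sums_def by blast
  also have "{S. S \<subseteq> a ` {1..r} \<and> S \<noteq> {}} = image a ` letters"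
    unfolding letters_def subset_image_iff by blast
  also have "Sum ` image a ` letters = (\<lambda>S. \<Sum>(a ` S)) ` letters"
    by (rule image_image)
  also have "\<dots> = subset_sum ` letters"
    by (rule image_cong) (auto simp: letters_def sum_image_a)
  finally show ?thesis .
qed

abbreviation "residues \<equiv> neg_residues N (subset_sums (a ` {1..r}))"

text \<open>For one colour, \<open>a i < N\<close>. For more colours, \<open>j\<close> is at least 2
  while the sum is at most \<open>N\<close>.\<close>

lemma part_pos:
  assumes "S \<in> letters" "card S \<le> j"
  shows "0 < int N * int j - subset_sum S"
proof (cases "card S = 1")
  case True
  then obtain i where S: "S = {i}" by (auto simp: card_1_singleton_iff)
  have "int N * 1 \<le> int N * int j" using assms(2) True by (intro mult_left_mono) auto
  then show ?thesis using a_less[of i] assms(1) by (auto simp: S letters_def subset_sum_def)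
next
  case False
  then have "2 \<le> j" using assms card_letter_pos[of S] by linarith
  then have "int N * 2 \<le> int N * int j" by (intro mult_left_mono) auto
  moreover have "subset_sum S \<le> int N" using subset_sum_bounds[OF assms(1)] by simp
  ultimately show ?thesis using N_pos by linarith
qed

lemma part_in_residues:
  assumes "S \<in> letters" "card S \<le> j" "int u = int N * int j - subset_sum S"
  shows "u \<in> residues"
proof -
  have "[int u = - subset_sum S] (mod int N)" using assms(3) by (simp add: cong_iff_dvd_diff)
  then show ?thesis
    using assms part_pos[OF assms(1,2)] unfolding neg_residues_def subset_sums_eq by auto
qed

lemma residue_cases:
  assumes "u \<in> residues"
  obtains S j where "S \<in> letters" "int u = int N * int j - subset_sum S"
proof -
  obtain S where S: "S \<in> letters" "[int u = - subset_sum S] (mod int N)" and "u > 0"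
    using assms unfolding neg_residues_def subset_sums_eq by auto
  then have "int N dvd int u + subset_sum S" by (simp add: cong_iff_dvd_diff)
  then obtain q where q: "int u + subset_sum S = int N * q" by blast
  have "0 < int N * q" using q \<open>u > 0\<close> subset_sum_bounds[OF S(1)] by auto
  then have "q > 0" using N_pos by (simp add: zero_less_mult_iff)
  then show thesis using that[OF S(1), of "nat q"] q by simp
qed

section \<open>The difference condition in terms of multiples and index sets\<close>

definition step :: "nat \<times> bool \<Rightarrow> nat \<times> bool \<Rightarrow> bool" where
  "step p q \<longleftrightarrow> (let b = \<beta> N (- int (fst p)) in int (fst p) - int (fst q)
     \<ge> int N * (int (w (a ` {1..r}) b) - 1 + \<chi> q) + v (a ` {1..r}) b - b)"

text \<open>The difference condition already enforces the order and the overlining rule: a singleton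
  letter leaves the bound \<open>N * \<chi> q\<close>, and a larger letter leaves a positive
  bound.\<close>

lemma step_dominates:
  assumes S: "S \<in> letters" "int (fst p) = int N * j - subset_sum S" and "step p q"
  shows "dominates p q"
proof -
  have le: "int N * (int (card S) - 1 + \<chi> q) + a (Min S) - subset_sum S \<le> int (fst p) - int (fst q)"
    using assms(3) unfolding step_def beta_part[OF S] w_eq[OF S(1)] v_eq[OF S(1)] Let_def .
  have chi: "\<chi> q = (if snd q then 1 else 0)" by (simp add: \<chi>_def)
  show ?thesis
  proof (cases "card S = 1")
    case True
    then obtain i where "S = {i}" by (auto simp: card_1_singleton_iff)
    then show ?thesis using le N_pos by (auto simp: chi subset_sum_def dominates_def split: if_splits)
  next
    case False
    then have "1 \<le> int (card S) - 1 + \<chi> q" using card_letter_pos[OF S(1)] by (auto simp: chi)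
    then have "int N * 1 \<le> int N * (int (card S) - 1 + \<chi> q)" by (intro mult_left_mono) auto
    moreover have "0 < a (Min S)" using a_pos letter_Min_in[OF S(1)] by blast
    moreover have "subset_sum S \<le> int N" using subset_sum_bounds[OF S(1)] by simp
    ultimately have "int (fst q) < int (fst p)" using le by linarith
    then show ?thesis by (simp add: dominates_def)
  qed
qed

text \<open>The condition becomes \<open>a (Min S) - subset_sum T \<le> N * d\<close> with
  \<open>d\<close> an integer. Its left side lies strictly between \<open>- N\<close> and
  \<open>N\<close>, and by superincrease it is positive exactly when \<open>Max T < Min S\<close>.
  So the least admissible \<open>d\<close> is 1 in that case and 0 otherwise.\<close>

lemma step_iff:
  assumes S: "S \<in> letters" "int (fst p) = int N * j - subset_sum S"
    and T: "T \<in> letters" "int (fst q) = int N * j' - subset_sum T"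
  shows "step p q \<longleftrightarrow> int (card S) - 1 + \<chi> q + (if Max T < Min S then 1 else 0) \<le> j - j'"
proof -
  define d where "d = j - j' - (int (card S) - 1 + \<chi> q)"
  have "step p q \<longleftrightarrow> a (Min S) - subset_sum T \<le> int N * d"
    unfolding step_def beta_part[OF S] w_eq[OF S(1)] v_eq[OF S(1)] Let_def
    unfolding S(2) T(2) d_def by (simp add: algebra_simps)
  also have "\<dots> \<longleftrightarrow> (if Max T < Min S then 1 else 0) \<le> d"
  proof (cases "Max T < Min S")
    case True
    have "subset_sum T < a (Min S)"
      using True T(1) finite_letter[OF T(1)] letter_Min_in[OF S(1)]
      by (intro subset_sum_less) (auto simp: letters_def)
    moreover have "int N \<le> int N * d" if "1 \<le> d"
      using mult_left_mono[OF that, of "int N"] by simp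
    moreover have "int N * d \<le> 0" if "\<not> 1 \<le> d"
      using that by (simp add: mult_le_0_iff)
    moreover have "a (Min S) < int N" using a_less letter_Min_in[OF S(1)] by blast
    moreover have "1 \<le> subset_sum T" using subset_sum_bounds[OF T(1)] by simp
    ultimately have "a (Min S) - subset_sum T \<le> int N * d \<longleftrightarrow> 1 \<le> d" by linarith
    then show ?thesis using True by simp
  next
    case False
    have MT: "Max T \<in> T" "T \<subseteq> {1..r}"
      using T(1) finite_letter[OF T(1)] by (auto simp: letters_def)
    then have "a (Min S) \<le> a (Max T)"
      using a_mono[of "Min S" "Max T"] False letter_Min_in[OF S(1)] by (cases "Min S = Max T") auto
    then have "a (Min S) \<le> subset_sum T" using le_subset_sum[OF MT] by linarith
    moreover have "0 \<le> int N * d" if "0 \<le> d" using that by simp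
    moreover have "int N * d \<le> - int N" if "\<not> 0 \<le> d"
      using mult_left_mono[of d "-1" "int N"] that by simp
    moreover have "0 < a (Min S)" using a_pos letter_Min_in[OF S(1)] by blast
    moreover have "subset_sum T \<le> int N" using subset_sum_bounds[OF T(1)] by simp
    ultimately have "a (Min S) - subset_sum T \<le> int N * d \<longleftrightarrow> 0 \<le> d" by linarith
    then show ?thesis using False by simp
  qed
  finally show ?thesis by (auto simp: d_def)
qed

text \<open>The two conditions in recursive form, to match the recursions of \<open>offset\<close>
  and \<open>encode\<close>.\<close>

fun admissible :: "(nat \<times> bool) list \<Rightarrow> bool" where
  "admissible [] \<longleftrightarrow> True"
| "admissible [p] \<longleftrightarrow>
     int (fst p) \<ge> int N * (int (w (a ` {1..r}) (\<beta> N (- int (fst p)))) - 1)"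
| "admissible (p # q # xs) \<longleftrightarrow> step p q \<and> admissible (q # xs)"

lemma admissible_iff:
  "admissible xs \<longleftrightarrow> difference_condition (a ` {1..r}) N xs \<and> last_part_condition (a ` {1..r}) N xs"
proof (induction xs rule: admissible.induct)
  case (3 p q xs)
  have split: "(\<forall>i. P i) \<longleftrightarrow> P 0 \<and> (\<forall>i. P (Suc i))" for P :: "nat \<Rightarrow> bool"
    by (metis not0_implies_Suc)
  have "difference_condition (a ` {1..r}) N (p # q # xs) \<longleftrightarrow>
      step p q \<and> difference_condition (a ` {1..r}) N (q # xs)"
    unfolding difference_condition_def step_def
    by (subst split) (simp add: Let_def)
  then show ?case using 3 by (auto simp: last_part_condition_def)
qed (auto simp: difference_condition_def last_part_condition_def)

text \<open>An overline enters only through the difference to the preceding part, and the first part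
  has no predecessor.\<close>

lemma admissible_toggle: "admissible ((p, b) # xs) \<Longrightarrow> admissible ((p, b') # xs)"
  by (cases xs) (auto simp: step_def)

section \<open>Encoding words and excesses as overpartitions\<close>

fun encode :: "nat set list \<Rightarrow> (nat \<times> bool) list \<Rightarrow> (nat \<times> bool) list" where
  "encode (S # ws) (p # ps) =
     (nat (int N * int (offset (S # ws) + fst p) - subset_sum S), snd p) # encode ws ps"
| "encode _ _ = []"

lemma card_le_offset: "set ws \<subseteq> letters \<Longrightarrow> S \<in> letters \<Longrightarrow> card S \<le> offset (S # ws)"
  using offset_ge_1[of ws] by (cases ws) auto

text \<open>The offset is at least \<open>card S\<close>, so the value is positive and
  \<open>nat\<close> loses nothing.\<close>

lemma encode_head:
  assumes "S \<in> letters" "set ws \<subseteq> letters"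
  shows "int (nat (int N * int (offset (S # ws) + l) - subset_sum S))
    = int N * int (offset (S # ws) + l) - subset_sum S"
  using part_pos[OF assms(1), of "offset (S # ws) + l"] card_le_offset[OF assms(2,1)] by simp

text \<open>By \<open>step_iff\<close> the offsets absorb the fixed share of each difference; what
  remains is exactly \<open>dominates\<close> between neighbouring excesses.\<close>

lemma encode_admissible:
  assumes "set ws \<subseteq> letters" "length ps = length ws" "sorted_wrt dominates ps"
  shows "admissible (encode ws ps)" and "sorted_wrt dominates (encode ws ps)"
    and "fst ` set (encode ws ps) \<subseteq> residues"
    and "int (sum_list (map fst (encode ws ps))) =
      int N * int (total_offset ws + sum_list (map fst ps)) - (\<Sum>S\<leftarrow>ws. subset_sum S)"
    and "num_non_overlined (encode ws ps) = num_non_overlined ps"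
proof -
  have "admissible (encode ws ps) \<and> sorted_wrt dominates (encode ws ps) \<and>
    fst ` set (encode ws ps) \<subseteq> residues \<and>
    int (sum_list (map fst (encode ws ps))) =
      int N * int (total_offset ws + sum_list (map fst ps)) - (\<Sum>S\<leftarrow>ws. subset_sum S) \<and>
    num_non_overlined (encode ws ps) = num_non_overlined ps"
    using assms
  proof (induction ws ps rule: encode.induct)
    case (1 S ws p ps)
    let ?q = "(nat (int N * int (offset (S # ws) + fst p) - subset_sum S), snd p)"
    have S: "S \<in> letters" and ws: "set ws \<subseteq> letters" using "1.prems" by auto
    have q: "int (fst ?q) = int N * int (offset (S # ws) + fst p) - subset_sum S"
      using encode_head[OF S ws] by simp
    have IH: "admissible (encode ws ps)" "sorted_wrt dominates (encode ws ps)"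
      "fst ` set (encode ws ps) \<subseteq> residues"
      "int (sum_list (map fst (encode ws ps))) =
        int N * int (total_offset ws + sum_list (map fst ps)) - (\<Sum>S\<leftarrow>ws. subset_sum S)"
      "num_non_overlined (encode ws ps) = num_non_overlined ps"
      using "1.IH" "1.prems" by auto
    have "fst ?q \<in> residues"
      using card_le_offset[OF ws S] by (intro part_in_residues[OF S _ q]) simp
    moreover have "int (sum_list (map fst (encode (S # ws) (p # ps)))) =
        int N * int (total_offset (S # ws) + sum_list (map fst (p # ps)))
        - (\<Sum>S\<leftarrow>S # ws. subset_sum S)"
      using q IH(4) by (simp add: algebra_simps)
    moreover have "admissible (?q # encode ws ps) \<and> sorted_wrt dominates (?q # encode ws ps)"
    proof (cases ws)
      case Nil
      have "int N * (int (card S) - 1) \<le> int (fst ?q)"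
      proof -
        have "int N * int (card S) \<le> int N * int (offset (S # ws) + fst p)"
          using card_le_offset[OF ws S] by (intro mult_left_mono of_nat_mono) auto
        moreover have "subset_sum S \<le> int N" using subset_sum_bounds[OF S] by simp
        ultimately show ?thesis unfolding q by (simp add: algebra_simps)
      qed
      then have "admissible [?q]"
        unfolding admissible.simps beta_part[OF S q] w_eq[OF S] .
      then show ?thesis by (simp add: Nil)
    next
      case (Cons T us)
      then obtain p' ps' where ps: "ps = p' # ps'" using "1.prems"(2) by (cases ps) auto
      let ?q' = "(nat (int N * int (offset (T # us) + fst p') - subset_sum T), snd p')"
      have T: "T \<in> letters" and us: "set us \<subseteq> letters" using ws Cons by auto
      have q': "int (fst ?q') = int N * int (offset (T # us) + fst p') - subset_sum T"
        using encode_head[OF T us] by simp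
      have enc: "encode ws ps = ?q' # encode us ps'" by (simp add: Cons ps)
      have "dominates p p'" using "1.prems"(3) by (simp add: ps)
      then have "int (fst p') + \<chi> ?q' \<le> int (fst p)" by (auto simp: dominates_def \<chi>_def)
      then have "step ?q ?q'"
        unfolding step_iff[OF S q T q'] using card_letter_pos[OF S] by (auto simp: Cons)
      then have "admissible (?q # encode ws ps)" "dominates ?q ?q'"
        using IH(1) step_dominates[OF S q] by (simp_all add: enc)
      \<comment> \<open>By transitivity it is enough that the new part dominates the next
        one.\<close>
      then show ?thesis
        using IH(2) unfolding enc by (simp add: sorted_wrt2[OF transp_dominates] del: sorted_wrt.simps)
    qed
    ultimately show ?case using IH(3,5) by (simp add: num_non_overlined_def)
  qed (auto simp: num_non_overlined_def)
  then show "admissible (encode ws ps)" "sorted_wrt dominates (encode ws ps)"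
    "fst ` set (encode ws ps) \<subseteq> residues"
    "int (sum_list (map fst (encode ws ps))) =
      int N * int (total_offset ws + sum_list (map fst ps)) - (\<Sum>S\<leftarrow>ws. subset_sum S)"
    "num_non_overlined (encode ws ps) = num_non_overlined ps"
    by blast+
qed

text \<open>Both sums lie between 1 and \<open>N\<close> and agree modulo \<open>N\<close>.\<close>

lemma part_unique:
  assumes "S \<in> letters" "T \<in> letters" "int N * j - subset_sum S = int N * j' - subset_sum T"
  shows "S = T" "j = j'"
proof -
  have "int N * (j - j') = subset_sum S - subset_sum T"
    using assms(3) by (simp add: algebra_simps)
  then have "[subset_sum S = subset_sum T] (mod int N)"
    by (metis cong_iff_dvd_diff dvd_triv_left)
  then have "[subset_sum S - 1 = subset_sum T - 1] (mod int N)" by (simp add: cong_diff)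
  then have "subset_sum S = subset_sum T"
    using subset_sum_bounds[OF assms(1)] subset_sum_bounds[OF assms(2)]
      cong_less_imp_eq_int[of "subset_sum S - 1" "int N" "subset_sum T - 1"] by auto
  then show "S = T" using subset_sum_inj assms by blast
  then show "j = j'" using assms(3) N_pos by simp
qed

lemma encode_inj:
  assumes "set ws \<subseteq> letters" "length ps = length ws" "set us \<subseteq> letters" "length qs = length us"
    and "encode ws ps = encode us qs"
  shows "ws = us \<and> ps = qs"
  using assms
proof (induction ws ps arbitrary: us qs rule: encode.induct)
  case (1 S ws p ps)
  obtain T us' q qs' where us: "us = T # us'" and qs: "qs = q # qs'"
    using "1.prems" by (cases us; cases qs) auto
  have IH: "ws = us'" "ps = qs'"
    using "1.IH"[of us' qs'] "1.prems" by (auto simp: us qs)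
  have L: "S \<in> letters" "T \<in> letters" "set ws \<subseteq> letters" "set us' \<subseteq> letters"
    using "1.prems" by (auto simp: us)
  have eq: "nat (int N * int (offset (S # ws) + fst p) - subset_sum S) =
      nat (int N * int (offset (T # us') + fst q) - subset_sum T)" and snd: "snd p = snd q"
    using "1.prems"(5) by (simp_all add: us qs)
  have "int N * int (offset (S # ws) + fst p) - subset_sum S =
      int N * int (offset (T # us') + fst q) - subset_sum T"
    by (rule trans[OF encode_head[OF L(1,3), symmetric]
          trans[OF arg_cong[OF eq, where f = int] encode_head[OF L(2,4)]]])
  from part_unique[OF L(1,2) this] have "S = T" "fst p = fst q" using IH by auto
  then show ?case using IH snd by (simp add: us qs prod_eq_iff)
qed (auto split: list.splits, (metis encode.simps(1) length_0_conv list.distinct(1) neq_Nil_conv)+)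

text \<open>Decoding proceeds from the smallest part upwards: \<open>residue_cases\<close> supplies
  the letter and \<open>j\<close>, and \<open>step_iff\<close> shows that \<open>j\<close> reaches
  the offset with an excess dominating the next one.\<close>

lemma encode_surj:
  assumes "admissible xs" "fst ` set xs \<subseteq> residues"
  shows "\<exists>ws ps. set ws \<subseteq> letters \<and> length ps = length ws \<and> sorted_wrt dominates ps \<and>
    encode ws ps = xs"
  using assms
proof (induction xs)
  case Nil
  show ?case by (intro exI[of _ "[]"]) auto
next
  case (Cons p xs)
  have "admissible xs" using Cons.prems(1) by (cases xs) auto
  then obtain ws ps where w: "set ws \<subseteq> letters" "length ps = length ws" "sorted_wrt dominates ps"
    "encode ws ps = xs" using Cons by auto
  obtain S j where S: "S \<in> letters" and j: "int (fst p) = int N * int j - subset_sum S"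
    using residue_cases[of "fst p"] Cons.prems(2) by auto
  have "\<exists>l. j = offset (S # ws) + l \<and> sorted_wrt dominates ((l, snd p) # ps)"
  proof (cases ws)
    case Nil
    then have "int N * (int (card S) - 1) \<le> int (fst p)"
      using Cons.prems(1) w(4) beta_part[OF S j] w_eq[OF S] by simp
    moreover have "1 \<le> subset_sum S" using subset_sum_bounds[OF S] by simp
    \<comment> \<open>The inequality is strict because the subset sum is positive; this improves
      \<open>card S - 1 \<le> j\<close> to \<open>card S \<le> j\<close>.\<close>
    ultimately have "int N * (int (card S) - 1) < int N * int j" using j by linarith
    then have "card S \<le> j" using N_pos by (simp add: mult_less_cancel_left_pos)
    then show ?thesis using Nil w(2) by (intro exI[of _ "j - card S"]) auto
  next
    case W: (Cons T us)
    then obtain p' ps' where ps: "ps = p' # ps'" using w(2) by (cases ps) auto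
    let ?q' = "(nat (int N * int (offset (T # us) + fst p') - subset_sum T), snd p')"
    have T: "T \<in> letters" and us: "set us \<subseteq> letters" using w(1) W by auto
    have q': "int (fst ?q') = int N * int (offset (T # us) + fst p') - subset_sum T"
      using encode_head[OF T us] by simp
    have xs: "xs = ?q' # encode us ps'" using w(4) by (simp add: W ps)
    have "step p ?q'" using Cons.prems(1) by (simp add: xs)
    then have le: "int (offset (S # ws)) + int (fst p') + \<chi> p' \<le> int j"
      unfolding step_iff[OF S j T q'] using card_letter_pos[OF S] by (auto simp: W \<chi>_def)
    \<comment> \<open>By \<open>le\<close> this subtraction is not truncated.\<close>
    define l where "l = j - offset (S # ws)"
    have l: "j = offset (S # ws) + l" "int (fst p') + \<chi> p' \<le> int l"
      using le by (auto simp: l_def \<chi>_def split: if_splits)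
    then have "dominates (l, snd p) p'" by (auto simp: dominates_def \<chi>_def split: if_splits)
    then have "sorted_wrt dominates ((l, snd p) # ps)"
      using w(3) unfolding ps by (simp add: sorted_wrt2[OF transp_dominates] del: sorted_wrt.simps)
    then show ?thesis using l(1) by blast
  qed
  then obtain l where l: "j = offset (S # ws) + l" "sorted_wrt dominates ((l, snd p) # ps)"
    by blast
  have "nat (int N * int (offset (S # ws) + l) - subset_sum S) = fst p"
    using j unfolding l(1) by linarith
  then have "encode (S # ws) ((l, snd p) # ps) = p # xs" using w(4) by (simp del: offset.simps)
  then show ?case using w S l(2)
    by (intro exI[of _ "S # ws"] exI[of _ "(l, snd p) # ps"]) auto
qed

section \<open>Counting under the difference conditions by words\<close>

definition difference_overpartitions :: "nat \<Rightarrow> (nat \<times> bool) list set" where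
  "difference_overpartitions n =
     {xs. is_overpartition xs n \<and> fst ` set xs \<subseteq> residues \<and> admissible xs}"

text \<open>Both sides correspond to the set \<open>W\<close> of words with sorted excess lists: one
  by splitting the list into its overlined and non-overlined entries, the other by encoding.\<close>

lemma bij_betw_words:
  "\<exists>f. bij_betw f (words r k n) {xs \<in> difference_overpartitions n. num_non_overlined xs = k}"
proof -
  define W where "W = {(ws, ps). set ws \<subseteq> letters \<and> length ps = length ws \<and>
    sorted_wrt dominates ps \<and> num_non_overlined ps = k \<and>
    int N * int (total_offset ws + sum_list (map fst ps)) - (\<Sum>S\<leftarrow>ws. subset_sum S) = int n}"
  have "bij_betw (\<lambda>(ws, ps). (ws, overlined ps, non_overlined ps)) W (words r k n)"
    unfolding bij_betw_def
  proof
    show "inj_on (\<lambda>(ws, ps). (ws, overlined ps, non_overlined ps)) W"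
      using dominates_sorted_unique by (auto simp: inj_on_def W_def)
    show "(\<lambda>(ws, ps). (ws, overlined ps, non_overlined ps)) ` W = words r k n"
    proof (intro equalityI subsetI)
      fix z assume "z \<in> (\<lambda>(ws, ps). (ws, overlined ps, non_overlined ps)) ` W"
      then obtain ws ps where z: "z = (ws, overlined ps, non_overlined ps)" and W: "(ws, ps) \<in> W"
        by auto
      have "\<not> r < Min (last ws)" if "ws \<noteq> []"
      proof -
        have "last ws \<in> letters" using W that by (auto simp: W_def)
        then show ?thesis using letter_Min_in by fastforce
      qed
      then show "z \<in> words r k n"
        using W by (auto simp: z W_def words_def weight_def size_non_overlined
            length_eq_card_overlined sum_list_eq_sum_overlined algebra_simps)
    next
      fix z assume z: "z \<in> words r k n"
      obtain ws Q M where zz: "z = (ws, Q, M)" by (rule prod_cases3)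
      then have "finite Q" using z by (simp add: words_def)
      then obtain ps where "sorted_wrt dominates ps" "overlined ps = Q" "non_overlined ps = M"
        using dominates_sorted_exists by blast
      then have "(ws, ps) \<in> W"
        using z length_eq_card_overlined[of ps] sum_list_eq_sum_overlined[of ps]
          size_non_overlined[of ps]
        by (auto simp: zz W_def words_def weight_def algebra_simps)
      then show "z \<in> (\<lambda>(ws, ps). (ws, overlined ps, non_overlined ps)) ` W"
        using \<open>overlined ps = Q\<close> \<open>non_overlined ps = M\<close> by (force simp: zz)
    qed
  qed
  then have "bij_betw (inv_into W (\<lambda>(ws, ps). (ws, overlined ps, non_overlined ps))) (words r k n) W"
    by (rule bij_betw_inv_into)
  moreover have "bij_betw (\<lambda>(ws, ps). encode ws ps) W
      {xs \<in> difference_overpartitions n. num_non_overlined xs = k}"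
    unfolding bij_betw_def
  proof
    show "inj_on (\<lambda>(ws, ps). encode ws ps) W"
      using encode_inj by (auto simp: inj_on_def W_def)
    show "(\<lambda>(ws, ps). encode ws ps) ` W =
        {xs \<in> difference_overpartitions n. num_non_overlined xs = k}"
    proof (intro equalityI subsetI)
      fix xs assume "xs \<in> (\<lambda>(ws, ps). encode ws ps) ` W"
      then obtain ws ps where xs: "xs = encode ws ps" and W: "(ws, ps) \<in> W" by auto
      have "set ws \<subseteq> letters" "length ps = length ws" "sorted_wrt dominates ps"
        using W by (auto simp: W_def)
      note e = encode_admissible[OF this]
      have "\<forall>p\<in>set xs. fst p > 0" using e(3) by (auto simp: xs neg_residues_def)
      then show "xs \<in> {xs \<in> difference_overpartitions n. num_non_overlined xs = k}"
        using e W by (auto simp: xs difference_overpartitions_def is_overpartition_iff W_def)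
    next
      fix xs assume xs: "xs \<in> {xs \<in> difference_overpartitions n. num_non_overlined xs = k}"
      then obtain ws ps where e: "set ws \<subseteq> letters" "length ps = length ws"
        "sorted_wrt dominates ps" and enc: "encode ws ps = xs"
        using encode_surj[of xs] by (auto simp: difference_overpartitions_def)
      have "(ws, ps) \<in> W"
        using e xs encode_admissible(4,5)[OF e] unfolding enc
        by (auto simp: W_def difference_overpartitions_def is_overpartition_iff)
      then show "xs \<in> (\<lambda>(ws, ps). encode ws ps) ` W" using enc by force
    qed
  qed
  ultimately show ?thesis by (meson bij_betw_trans)
qed

lemma finite_difference_overpartitions: "finite (difference_overpartitions n)"
  by (rule finite_subset[OF _ finite_overpartitions[of n]]) (auto simp: difference_overpartitions_def)

lemma card_words:
  "card (words r k n) = card {xs \<in> difference_overpartitions n. num_non_overlined xs = k}"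
  using bij_betw_words[of k n] by (elim exE) (rule bij_betw_same_card)

text \<open>Finiteness is carried over from the overpartitions of \<open>n\<close> through the
  bijection.\<close>

lemma finite_words: "m \<le> r \<Longrightarrow> finite (words m k n)"
proof -
  assume "m \<le> r"
  have "finite (words r k n)"
    using bij_betw_words[of k n] finite_difference_overpartitions bij_betw_finite by fastforce
  moreover have "words m k n \<subseteq> words r k n"
    using \<open>m \<le> r\<close> by (auto simp: words_def)
  ultimately show ?thesis by (rule rev_finite_subset)
qed

text \<open>The alternating sum is evaluated on the overpartitions, where the first part can be
  toggled.\<close>

lemma words_recurrence:
  "andrews_recurrence r N least_part (\<lambda>m k n. int (card (words m k n)))"
  unfolding andrews_recurrence_def
proof (intro conjI allI impI)
  fix n
  show "(\<Sum>k\<le>n. (-1) ^ k * int (card (words r k n))) = (if n = 0 then 1 else 0)"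
    unfolding card_words
  proof (rule alternating_sum_overpartitions)
    show "[] \<in> difference_overpartitions n" if "n = 0"
      using that by (simp add: difference_overpartitions_def is_overpartition_def)
    show "(p, \<not> b) # xs \<in> difference_overpartitions n"
      if "(p, b) # xs \<in> difference_overpartitions n" for p b xs
      using that is_overpartition_toggle[of p b xs n "\<not> b"] admissible_toggle[of p b xs "\<not> b"]
      unfolding difference_overpartitions_def by auto
  qed (auto simp: difference_overpartitions_def)
next
  fix m k n assume "m < r"
  then show "int (card (words (Suc m) k n)) = int (card (words m k n)) +
    (if 0 < k \<and> least_part (Suc m) \<le> n
     then int (card (words (Suc m) (k - 1) (n - least_part (Suc m)))) else 0)"
    using words_Suc[OF _ finite_words] by simp
qed (simp add: words_zero)

lemma G_eq: "G (a ` {1..r}) N k n = card (words r k n)"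
  unfolding G_def card_words difference_overpartitions_def admissible_iff
  by (rule arg_cong[where f = card]) blast

subsection \<open>Overpartitions into parts of single colours\<close>

abbreviation "color_residues \<equiv> neg_residues N (a ` {1..r})"

lemma color_residues_iff: "u \<in> color_residues \<longleftrightarrow> u > 0 \<and> (\<exists>i\<in>{1..r}. int N dvd int u + a i)"
  by (auto simp: neg_residues_def cong_iff_dvd_diff)

lemma least_part_in: "i \<in> {1..r} \<Longrightarrow> least_part i \<in> color_residues"
  unfolding color_residues_iff using int_least_part[of i] least_part_pos[of i] by force

lemma color_residues_add: "u \<in> color_residues \<Longrightarrow> N + u \<in> color_residues"
  unfolding color_residues_iff by (simp add: add.assoc)

lemma color_residues_diff:
  assumes "u \<in> color_residues" "N \<le> u"
  shows "u - N \<in> color_residues"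
proof -
  obtain i where i: "i \<in> {1..r}" "int N dvd int u + a i"
    using assms(1) unfolding color_residues_iff by blast
  \<comment> \<open>This excludes \<open>u = N\<close>, so that \<open>u - N\<close> remains
    positive.\<close>
  have "\<not> int N dvd a i" using zdvd_imp_le[of "int N" "a i"] a_pos[OF i(1)] a_less[OF i(1)] by auto
  then have "u \<noteq> N" using i(2) by auto
  moreover have "int (u - N) + a i = int u + a i - int N" using assms(2) by (simp add: of_nat_diff)
  then have "int N dvd int (u - N) + a i" using i(2) by (metis dvd_diff dvd_refl)
  ultimately show ?thesis using i(1) assms(2) unfolding color_residues_iff by auto
qed

lemma color_residues_small:
  assumes "u \<in> color_residues" "u < N"
  obtains i where "i \<in> {1..r}" "u = least_part i"
proof -
  obtain i where i: "i \<in> {1..r}" "int N dvd int u + a i" and "u > 0"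
    using assms(1) unfolding color_residues_iff by blast
  obtain q where q: "int u + a i = int N * q" using i(2) by blast
  have "0 < int N * q" "int N * q < int N * 2"
    using q assms(2) \<open>u > 0\<close> a_pos[OF i(1)] a_less[OF i(1)] by linarith+
  then have "q = 1" using N_pos by (simp add: zero_less_mult_iff)
  then have "int u = int (least_part i)" using q int_least_part[OF i(1)] by simp
  then show thesis using that i(1) by simp
qed

lemma least_part_inj: "i \<in> {1..r} \<Longrightarrow> j \<in> {1..r} \<Longrightarrow> least_part i = least_part j \<Longrightarrow> i = j"
  using int_least_part[of i] int_least_part[of j] inj_onD[OF inj_on_a, of i j] by simp

text \<open>The counterpart of \<open>words\<close>: \<open>Q\<close> holds the overlined and
  \<open>M\<close> the non-overlined parts. The least parts of the colours are the only available
  parts below \<open>N\<close>, so at \<open>m = 0\<close> every non-overlined part is at least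
  \<open>N\<close>.\<close>

definition pairs :: "nat \<Rightarrow> nat \<Rightarrow> nat \<Rightarrow> (nat set \<times> nat multiset) set" where
  "pairs m k n = {(Q, M). finite Q \<and> Q \<subseteq> color_residues \<and> set_mset M \<subseteq> color_residues \<and>
     size M = k \<and> \<Sum>Q + \<Sum>\<^sub># M = n \<and> (\<forall>i\<in>{1..r}. m < i \<longrightarrow> least_part i \<notin># M)}"

lemma sum_mset_add: "\<Sum>\<^sub># (image_mset ((+) N) M) = N * size M + \<Sum>\<^sub># M"
  by (induction M) auto

lemma image_mset_add_diff: "\<forall>x\<in>#M. N \<le> x \<Longrightarrow> image_mset ((+) N) (image_mset (\<lambda>x. x - N) M) = M"
  by (induction M) auto

lemma image_mset_diff_add: "image_mset (\<lambda>x. x - N) (image_mset ((+) N) M) = M"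
  by (induction M) auto

lemma pairs_zero_le:
  assumes "(Q, M) \<in> pairs 0 k n" "x \<in># M"
  shows "N \<le> x"
proof (rule ccontr)
  assume "\<not> N \<le> x"
  moreover have "x \<in> color_residues" using assms by (auto simp: pairs_def)
  ultimately obtain i where "i \<in> {1..r}" "x = least_part i"
    using color_residues_small by (metis not_le)
  then show False using assms by (auto simp: pairs_def)
qed

text \<open>With the least parts absent from \<open>M\<close>, each of the \<open>k\<close>
  non-overlined parts can be lowered by \<open>N\<close> within its residue class.\<close>

lemma pairs_zero: "card (pairs 0 k n) = (if N * k \<le> n then card (pairs r k (n - N * k)) else 0)"
proof -
  have eq: "pairs 0 k n = (if N * k \<le> n
    then (\<lambda>(Q, M). (Q, image_mset ((+) N) M)) ` pairs r k (n - N * k) else {})"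
  proof (intro equalityI subsetI)
    fix z assume z: "z \<in> pairs 0 k n"
    obtain Q M where zz: "z = (Q, M)" by fastforce
    define L where "L = image_mset (\<lambda>x. x - N) M"
    have ge: "\<forall>x\<in>#M. N \<le> x" using z pairs_zero_le by (auto simp: zz)
    then have M: "M = image_mset ((+) N) L" by (simp only: L_def image_mset_add_diff)
    have "size L = k" using z by (simp add: L_def pairs_def zz)
    have n: "n = N * k + (\<Sum>Q + \<Sum>\<^sub># L)"
      using z \<open>size L = k\<close> unfolding zz M by (simp add: pairs_def sum_mset_add)
    have "set_mset M \<subseteq> color_residues" using z by (simp add: zz pairs_def)
    then have "set_mset L \<subseteq> color_residues"
      using ge color_residues_diff unfolding L_def set_image_mset by blast
    then have "(Q, L) \<in> pairs r k (n - N * k)"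
      using z \<open>size L = k\<close> by (auto simp: zz n pairs_def)
    then show "z \<in> (if N * k \<le> n
      then (\<lambda>(Q, M). (Q, image_mset ((+) N) M)) ` pairs r k (n - N * k) else {})"
      using n unfolding zz M by auto
  next
    fix z assume "z \<in> (if N * k \<le> n
      then (\<lambda>(Q, M). (Q, image_mset ((+) N) M)) ` pairs r k (n - N * k) else {})"
    then obtain Q M where z: "z = (Q, image_mset ((+) N) M)" "(Q, M) \<in> pairs r k (n - N * k)"
      and le: "N * k \<le> n" by (auto split: if_splits)
    \<comment> \<open>Shifted parts are at least \<open>N\<close>, and least parts are below
      \<open>N\<close>.\<close>
    have "least_part i \<noteq> N + x" if "i \<in> {1..r}" for i x
      using int_least_part[OF that] a_pos[OF that] by linarith
    then have "least_part i \<notin># image_mset ((+) N) M" if "i \<in> {1..r}" for i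
      using that by auto
    moreover have "set_mset (image_mset ((+) N) M) \<subseteq> color_residues"
      using z(2) color_residues_add by (auto simp: pairs_def)
    moreover have "\<Sum>Q + \<Sum>\<^sub># (image_mset ((+) N) M) = n" "size M = k"
      using z(2) le by (auto simp: pairs_def sum_mset_add)
    ultimately show "z \<in> pairs 0 k n" using z(2) unfolding z(1) by (simp add: pairs_def)
  qed
  have "inj_on (\<lambda>(Q, M). (Q, image_mset ((+) N) M)) (pairs r k (n - N * k))"
    by (rule inj_on_inverseI[where g = "\<lambda>(Q, M). (Q, image_mset (\<lambda>x. x - N) M)"])
      (auto simp only: image_mset_diff_add split)
  then show ?thesis unfolding eq by (simp add: card_image)
qed

text \<open>Either the least part of colour \<open>m + 1\<close> does not occur non-overlined, or
  one copy of it is removed.\<close>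

lemma pairs_Suc:
  assumes "m < r" "finite (pairs (Suc m) k n)"
  shows "card (pairs (Suc m) k n) = card (pairs m k n) +
    (if 0 < k \<and> least_part (Suc m) \<le> n
     then card (pairs (Suc m) (k - 1) (n - least_part (Suc m))) else 0)"
proof -
  let ?c = "least_part (Suc m)"
  let ?E = "{z \<in> pairs (Suc m) k n. ?c \<in># snd z}"
  have m: "Suc m \<in> {1..r}" using assms(1) by simp
  have "pairs m k n \<subseteq> pairs (Suc m) k n" by (auto simp: pairs_def)
  moreover have "pairs m k n \<inter> ?E = {}" using m by (auto simp: pairs_def)
  moreover have "pairs (Suc m) k n \<subseteq> pairs m k n \<union> ?E"
  proof
    fix z assume z: "z \<in> pairs (Suc m) k n"
    show "z \<in> pairs m k n \<union> ?E"
    proof (cases "?c \<in># snd z")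
      case False
      then have "least_part i \<notin># snd z" if "i \<in> {1..r}" "m < i" for i
        using z that by (cases "i = Suc m") (auto simp: pairs_def)
      then show ?thesis using z by (simp add: pairs_def split_beta)
    qed (use z in simp)
  qed
  ultimately have "pairs (Suc m) k n = pairs m k n \<union> ?E" "pairs m k n \<inter> ?E = {}" by auto
  then have "card (pairs (Suc m) k n) = card (pairs m k n) + card ?E"
    using assms(2) by (metis (no_types, lifting) card_Un_disjoint finite_Un)
  moreover have eq: "?E = (if 0 < k \<and> ?c \<le> n
      then (\<lambda>(Q, M). (Q, add_mset ?c M)) ` pairs (Suc m) (k - 1) (n - ?c) else {})"
  proof (intro equalityI subsetI)
    fix z assume z: "z \<in> ?E"
    obtain Q M where zz: "z = (Q, M)" by fastforce
    obtain L where M: "M = add_mset ?c L" using z by (auto simp: zz dest: multi_member_split)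
    have "(Q, L) \<in> pairs (Suc m) (k - 1) (n - ?c)" "0 < k" "?c \<le> n"
      using z unfolding zz M pairs_def by auto
    then show "z \<in> (if 0 < k \<and> ?c \<le> n
      then (\<lambda>(Q, M). (Q, add_mset ?c M)) ` pairs (Suc m) (k - 1) (n - ?c) else {})"
      unfolding zz M by auto
  next
    fix z assume "z \<in> (if 0 < k \<and> ?c \<le> n
      then (\<lambda>(Q, M). (Q, add_mset ?c M)) ` pairs (Suc m) (k - 1) (n - ?c) else {})"
    then obtain Q M where z: "z = (Q, add_mset ?c M)" "(Q, M) \<in> pairs (Suc m) (k - 1) (n - ?c)"
      and k: "0 < k" "?c \<le> n" by (auto split: if_splits)
    \<comment> \<open>Distinct colours have distinct least parts, so putting \<open>?c\<close> back
      introduces no forbidden part.\<close>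
    have "least_part i \<noteq> ?c" if "i \<in> {1..r}" "Suc m < i" for i
      using least_part_inj[OF that(1) m] that(2) by auto
    then show "z \<in> ?E"
      using z(2) k least_part_in[OF m] unfolding z(1) pairs_def by auto
  qed
  have "inj_on (\<lambda>(Q, M). (Q, add_mset ?c M)) (pairs (Suc m) (k - 1) (n - ?c))"
    by (auto simp: inj_on_def)
  then have "card ?E = (if 0 < k \<and> ?c \<le> n then card (pairs (Suc m) (k - 1) (n - ?c)) else 0)"
    unfolding eq by (simp add: card_image)
  ultimately show ?thesis by simp
qed

lemma bij_betw_pairs:
  "bij_betw (\<lambda>xs. (overlined xs, non_overlined xs))
     {xs. is_overpartition xs n \<and> fst ` set xs \<subseteq> color_residues \<and> num_non_overlined xs = k}
     (pairs r k n)"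
  (is "bij_betw ?f ?X _")
  unfolding bij_betw_def
proof
  show "inj_on ?f ?X"
    using dominates_sorted_unique by (auto simp: inj_on_def is_overpartition_iff)
  show "?f ` ?X = pairs r k n"
  proof (intro equalityI subsetI)
    fix z assume "z \<in> ?f ` ?X"
    then obtain xs where z: "z = ?f xs" and xs: "xs \<in> ?X" by blast
    then show "z \<in> pairs r k n"
      using parts_eq[of xs] sum_list_eq_sum_overlined[of xs]
      by (auto simp: pairs_def size_non_overlined is_overpartition_iff)
  next
    fix z assume z: "z \<in> pairs r k n"
    obtain Q M where zz: "z = (Q, M)" by fastforce
    then have "finite Q" using z by (simp add: pairs_def)
    then obtain xs where xs: "sorted_wrt dominates xs" "overlined xs = Q" "non_overlined xs = M"
      using dominates_sorted_exists by blast
    have sub: "fst ` set xs \<subseteq> color_residues"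
      unfolding parts_eq xs(2,3) using z by (simp add: zz pairs_def)
    then have "\<forall>p\<in>set xs. fst p > 0" by (auto simp: neg_residues_def)
    then have "xs \<in> ?X"
      using z sub xs sum_list_eq_sum_overlined[OF xs(1)] size_non_overlined[of xs]
      by (simp add: zz pairs_def is_overpartition_iff)
    then show "z \<in> ?f ` ?X" using xs(2,3) by (force simp: zz)
  qed
qed

lemma F_eq: "F (a ` {1..r}) N k n = card (pairs r k n)"
  unfolding F_def by (rule bij_betw_same_card[OF bij_betw_pairs])

lemma finite_pairs: "m \<le> r \<Longrightarrow> finite (pairs m k n)"
proof -
  assume "m \<le> r"
  have "finite {xs. is_overpartition xs n \<and> fst ` set xs \<subseteq> color_residues \<and> num_non_overlined xs = k}"
    by (rule finite_subset[OF _ finite_overpartitions[of n]]) auto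
  then have "finite (pairs r k n)" using bij_betw_finite[OF bij_betw_pairs] by blast
  moreover have "pairs m k n \<subseteq> pairs r k n"
    using \<open>m \<le> r\<close> by (auto simp: pairs_def)
  ultimately show ?thesis by (rule rev_finite_subset)
qed

lemma pairs_recurrence:
  "andrews_recurrence r N least_part (\<lambda>m k n. int (card (pairs m k n)))"
  unfolding andrews_recurrence_def
proof (intro conjI allI impI)
  fix n
  let ?X = "{xs. is_overpartition xs n \<and> fst ` set xs \<subseteq> color_residues}"
  have "card (pairs r k n) = card {xs \<in> ?X. num_non_overlined xs = k}" for k
    unfolding F_eq[symmetric] F_def by (rule arg_cong[where f = card]) blast
  moreover have "(\<Sum>k\<le>n. (-1) ^ k * int (card {xs \<in> ?X. num_non_overlined xs = k})) =
      (if n = 0 then 1 else 0)"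
  proof (rule alternating_sum_overpartitions)
    show "[] \<in> ?X" if "n = 0" using that by (simp add: is_overpartition_def)
    show "(p, \<not> b) # xs \<in> ?X" if "(p, b) # xs \<in> ?X" for p b xs
      using that is_overpartition_toggle[of p b xs n "\<not> b"] by simp
  qed auto
  ultimately show "(\<Sum>k\<le>n. (-1) ^ k * int (card (pairs r k n))) = (if n = 0 then 1 else 0)"
    by simp
next
  fix m k n assume "m < r"
  then show "int (card (pairs (Suc m) k n)) = int (card (pairs m k n)) +
    (if 0 < k \<and> least_part (Suc m) \<le> n
     then int (card (pairs (Suc m) (k - 1) (n - least_part (Suc m)))) else 0)"
    using pairs_Suc[OF _ finite_pairs] by simp
qed (simp add: pairs_zero)

lemma F_eq_G: "F (a ` {1..r}) N k n = G (a ` {1..r}) N k n"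
  using andrews_recurrence_unique[OF pairs_recurrence words_recurrence N_pos least_part_pos, of r]
  unfolding F_eq G_eq by simp

end

subsection \<open>A single colour\<close>

text \<open>Here \<open>a 1 = N\<close> is possible, so the least positive part need not be \<open>N - a 1\<close>.\<close>

lemma F_eq_G_singleton:
  assumes "c \<in> {1..int N}"
  shows "F {c} N k n = G {c} N k n"
proof -
  have D: "defining_subset {c} c = {c}"
    unfolding defining_subset_def by (rule the_equality) auto
  have S: "subset_sums {c} = {c}"
    unfolding subset_sums_def subset_singleton_iff by force
  have beta: "\<beta> N (- int u) = c" if "u \<in> neg_residues N {c}" for u
    using that assms by (intro beta_eq) (auto simp: neg_residues_def)
  have "difference_condition {c} N xs \<and> last_part_condition {c} N xs"
    if "is_overpartition xs n" and sub: "fst ` set xs \<subseteq> neg_residues N {c}" for xs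
  proof
    \<comment> \<open>With one colour the set has one term, and \<open>v\<close> and
      \<open>\<beta>\<close> cancel, leaving this bound. All parts are congruent modulo
      \<open>N\<close>, so a strict descent is at least \<open>N\<close>.\<close>
    have "int N * \<chi> (xs ! Suc i) \<le> int (fst (xs ! i)) - int (fst (xs ! Suc i))"
      if i: "Suc i < length xs" for i
    proof -
      let ?p = "xs ! i" and ?q = "xs ! Suc i"
      have dom: "dominates ?p ?q"
        using \<open>is_overpartition xs n\<close> i unfolding is_overpartition_iff
        by (simp add: sorted_wrt_iff_nth_less)
      have "fst ?p \<in> neg_residues N {c}" "fst ?q \<in> neg_residues N {c}"
        using sub i by auto
      then have "[int (fst ?p) = - c] (mod int N)" "[int (fst ?q) = - c] (mod int N)"
        by (simp_all add: neg_residues_def)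
      then have "[int (fst ?p) = int (fst ?q)] (mod int N)" by (metis cong_sym cong_trans)
      then have dvd: "int N dvd int (fst ?p) - int (fst ?q)" by (simp add: cong_iff_dvd_diff)
      show ?thesis
      proof (cases "snd ?q")
        case True
        then have "0 < int (fst ?p) - int (fst ?q)" using dom by (auto simp: dominates_def)
        then show ?thesis using zdvd_imp_le[OF dvd] True by (simp add: \<chi>_def)
      next
        case False
        then show ?thesis using dom by (simp add: dominates_def \<chi>_def)
      qed
    qed
    then show "difference_condition {c} N xs"
      using sub beta by (auto simp: difference_condition_def Let_def w_def v_def D image_subset_iff)
    show "last_part_condition {c} N xs"
      using sub beta by (auto simp: last_part_condition_def w_def D image_subset_iff)
  qed
  then show ?thesis unfolding F_def G_def S by (intro arg_cong[where f = card]) blast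
qed

theorem theorem1p6:
  fixes r N n k :: nat and a :: "nat \<Rightarrow> int" and A :: "int set"
  assumes "r \<ge> 1"
    and "A = a ` {1..r}"
    and "inj_on a {1..r}"
    and "\<forall>j\<in>{1..r}. (\<Sum>i=1..<j. a i) < a j"
    and "inj_on (\<lambda>S. \<Sum>S) {S. S \<subseteq> A \<and> S \<noteq> {}}"
    and "N > 0"
    and "int N \<ge> (\<Sum>i=1..r. a i)"
    and "n \<ge> 1"
  shows "F A N k n = G A N k n"
proof (cases "r = 1")
  case True
  then have "A = {a 1}" "a 1 \<in> {1..int N}" using assms by auto
  then show ?thesis using F_eq_G_singleton by simp
next
  case False
  then interpret superincreasing r N a
    by unfold_locales (use assms in auto)
  show ?thesis using F_eq_G assms(2) by simp
qed

end
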